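(* Let $\mathcal{M}=(A,E)$ be the margin graph of a preference profile. The $\mathsf{FUN}$ algorithm described in the context, followed by returning the set of vertices that are cycle dominated or not dominated in the resulting diagram $\mathcal{M}^{\mathsf{FUN}}$, can be executed in time polynomial in $|A|$.
   Context: Elections: $A$ is a finite set of alternatives; a preference profile $\mathcal{P}=(\succ_1,\dots,\succ_n)$, $n\ge 1$, consists of linear orders on $A$. The margin is $m(x,y)=|\{i: x\succ_i y\}|-|\{i: y\succ_i x\}|$. The margin graph $\mathcal{M}(\mathcal{P})=(A,E)$ is the weighted directed graph with edge set $E=\{(x,y)\in A\times A: x\neq y,\ m(x,y)\ge 0\}$, edge $(x,y)$ having weight $m(x,y)$, given as adjacency lists. In a directed graph on $A$, a path from $u$ to $v$ is a sequence of distinct vertices $u=p_1,\dots,p_\ell=v$ with each $(p_i,p_{i+1})$ an edge; its strength is the minimum margin of its edges. Edge and vertex states: each edge of the diagram $F$ built below carries a state in $\{\mathsf{Fix},\mathsf{BC},\mathsf{CC},\mathsf{CBC}\}$. Relative to the current $F$, a vertex $y$ is: not dominated if it has no incoming edge; fixedly dominated if it has exactly one incoming edge and it has state $\mathsf{Fix}$, or it has at least one incoming edge of state $\mathsf{BC}$ or $\mathsf{CBC}$; cycle dominated if it has at least one incoming edge and all its incoming edges have state $\mathsf{CC}$. The $\mathsf{FUN}$ algorithm: initialize $F=(A,\emptyset)$. Process the edges $(x,y)\in E$ in order of decreasing margin (equal margins in arbitrary order). For the current edge with $k=m(x,y)$: (1) If $y$ is fixedly dominated and some $(z,y)\in F$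 has $m(z,y)>k$, reject $(x,y)$ and go to the next edge. (2) If $F$ contains a path from $y$ to $x$ of strength $>k$: let $U$ be the set of vertices having a path to $x$ in $F$ of strength $>k$; if for every $u\in U$ there is a path $P$ in $F$ from $y$ to $u$ of strength $>k$ such that for every edge $(c,d)$ on $P$ with state $\mathsf{CC}$, every path in $F$ from $d$ to $c$ of strength $\ge m(c,d)$ contains the vertex $y$, then reject $(x,y)$ and go to the next edge. (3) Otherwise assign a tentative state: if $y$ is not dominated, state $\mathsf{Fix}$; else if $y$ is cycle dominated and some $(z,y)\in F$ has $m(z,y)>k$, state $\mathsf{CBC}$; else if $y$ is cycle dominated and all $(z,y)\in F$ have $m(z,y)=k$, state $\mathsf{BC}$; else ($y$ fixedly dominated) state $\mathsf{BC}$ and change the state of the incoming $\mathsf{Fix}$ edge of $y$ (if any) to $\mathsf{BC}$. Add $(x,y)$ to $F$. (4) Let $C$ be the set of edges of $F$ lying on a directed cycle with $(x,y)$ (edges $(u,v)\in F$ with $u$ reachable from $y$ and $x$ reachable from $v$ in $F$). If $C\neq\emptyset$, set the state of $(x,y)$ to $\mathsf{CC}$ and set to $\mathsf{CC}$ the state of every $e\in C$ with $m(e)=k$. The final $F$ is $\mathcal{M}^{\mathsf{FUN}}$. *)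

theory Defs
  imports Complex_Main "HOL-Library.Extended_Real" "HOL-Computational_Algebra.Polynomial"
begin

section \<open>Elections and margin graphs\<close>

text \<open>Voter \<open>i\<close> strictly prefers \<open>x\<close> to \<open>y\<close> iff \<open>(x, y) \<in> P ! i\<close>.\<close>

definition profile :: "'a set \<Rightarrow> 'a rel list \<Rightarrow> bool" where
  "profile A P \<longleftrightarrow> P \<noteq> [] \<and> (\<forall>R \<in> set P. R \<subseteq> A \<times> A \<and> strict_linear_order_on A R)"

definition margin :: "'a rel list \<Rightarrow> 'a \<times> 'a \<Rightarrow> int" where
  "margin P = (\<lambda>(x, y).
     int (card {i. i < length P \<and> (x, y) \<in> P ! i}) - int (card {i. i < length P \<and> (y, x) \<in> P ! i}))"

definition margin_edges :: "'a set \<Rightarrow> 'a rel list \<Rightarrow> ('a \<times> 'a) set" where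
  "margin_edges A P = {(x, y). x \<in> A \<and> y \<in> A \<and> x \<noteq> y \<and> margin P (x, y) \<ge> 0}"


section \<open>The FUN algorithm\<close>

datatype estate = Fix | BC | CC | CBC

text \<open>A diagram maps each of its edges to the state of that edge; its edge set is \<open>dom F\<close>.\<close>

type_synonym 'a diagram = "'a \<times> 'a \<Rightarrow> estate option"

definition path_edges :: "'a list \<Rightarrow> ('a \<times> 'a) set" where
  "path_edges p = set (zip p (tl p))"

definition is_path :: "'a diagram \<Rightarrow> 'a \<Rightarrow> 'a list \<Rightarrow> 'a \<Rightarrow> bool" where
  "is_path F u p v \<longleftrightarrow>
     p \<noteq> [] \<and> distinct p \<and> hd p = u \<and> last p = v \<and> path_edges p \<subseteq> dom F"

text \<open>The one-vertex path has no edges; its strength is \<open>\<infinity>\<close>.\<close>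

definition strength :: "('a \<times> 'a \<Rightarrow> int) \<Rightarrow> 'a list \<Rightarrow> ereal" where
  "strength m p = Min (insert \<infinity> ((\<lambda>e. ereal (real_of_int (m e))) ` path_edges p))"

definition incoming :: "'a diagram \<Rightarrow> 'a \<Rightarrow> ('a \<times> 'a) set" where
  "incoming F y = {e \<in> dom F. snd e = y}"

definition not_dominated :: "'a diagram \<Rightarrow> 'a \<Rightarrow> bool" where
  "not_dominated F y \<longleftrightarrow> incoming F y = {}"

definition fixedly_dominated :: "'a diagram \<Rightarrow> 'a \<Rightarrow> bool" where
  "fixedly_dominated F y \<longleftrightarrow>
     (\<exists>e. incoming F y = {e} \<and> F e = Some Fix) \<or>
     (\<exists>e \<in> incoming F y. F e = Some BC \<or> F e = Some CBC)"

definition cycle_dominated :: "'a diagram \<Rightarrow> 'a \<Rightarrow> bool" where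
  "cycle_dominated F y \<longleftrightarrow> incoming F y \<noteq> {} \<and> (\<forall>e \<in> incoming F y. F e = Some CC)"

definition reject_dominated :: "('a \<times> 'a \<Rightarrow> int) \<Rightarrow> 'a diagram \<Rightarrow> 'a \<Rightarrow> 'a \<Rightarrow> bool" where
  "reject_dominated m F x y \<longleftrightarrow>
     fixedly_dominated F y \<and> (\<exists>e \<in> incoming F y. m e > m (x, y))"

definition reject_cycle :: "'a set \<Rightarrow> ('a \<times> 'a \<Rightarrow> int) \<Rightarrow> 'a diagram \<Rightarrow> 'a \<Rightarrow> 'a \<Rightarrow> bool" where
  "reject_cycle A m F x y \<longleftrightarrow>
     (let k = ereal (real_of_int (m (x, y)));
          U = {u \<in> A. \<exists>p. is_path F u p x \<and> strength m p > k}
      in (\<exists>p. is_path F y p x \<and> strength m p > k) \<and>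
         (\<forall>u \<in> U. \<exists>p. is_path F y p u \<and> strength m p > k \<and>
            (\<forall>(c, d) \<in> path_edges p. F (c, d) = Some CC \<longrightarrow>
               (\<forall>q. is_path F d q c \<and> strength m q \<ge> ereal (real_of_int (m (c, d)))
                  \<longrightarrow> y \<in> set q))))"

definition add_edge :: "('a \<times> 'a \<Rightarrow> int) \<Rightarrow> 'a diagram \<Rightarrow> 'a \<Rightarrow> 'a \<Rightarrow> 'a diagram" where
  "add_edge m F x y =
     (let k = m (x, y) in
      if not_dominated F y then F((x, y) \<mapsto> Fix)
      else if cycle_dominated F y \<and> (\<exists>e \<in> incoming F y. m e > k) then F((x, y) \<mapsto> CBC)
      else if cycle_dominated F y \<and> (\<forall>e \<in> incoming F y. m e = k) then F((x, y) \<mapsto> BC)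
      else (\<lambda>e. if e \<in> incoming F y \<and> F e = Some Fix then Some BC else F e)((x, y) \<mapsto> BC))"

definition cycle_edges :: "'a diagram \<Rightarrow> 'a \<Rightarrow> 'a \<Rightarrow> ('a \<times> 'a) set" where
  "cycle_edges F x y = {(u, v) \<in> dom F. (y, u) \<in> (dom F)\<^sup>* \<and> (v, x) \<in> (dom F)\<^sup>*}"

definition mark_cycles :: "('a \<times> 'a \<Rightarrow> int) \<Rightarrow> 'a diagram \<Rightarrow> 'a \<Rightarrow> 'a \<Rightarrow> 'a diagram" where
  "mark_cycles m F x y =
     (if cycle_edges F x y = {} then F
      else (\<lambda>e. if e = (x, y) \<or> e \<in> cycle_edges F x y \<and> m e = m (x, y) then Some CC else F e))"

definition fun_step :: "'a set \<Rightarrow> ('a \<times> 'a \<Rightarrow> int) \<Rightarrow> 'a \<times> 'a \<Rightarrow> 'a diagram \<Rightarrow> 'a diagram" where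
  "fun_step A m = (\<lambda>(x, y) F.
     if reject_dominated m F x y then F
     else if reject_cycle A m F x y then F
     else mark_cycles m (add_edge m F x y) x y)"

definition fun_diagram :: "'a set \<Rightarrow> ('a \<times> 'a \<Rightarrow> int) \<Rightarrow> ('a \<times> 'a) list \<Rightarrow> 'a diagram" where
  "fun_diagram A m es = fold (fun_step A m) es Map.empty"

definition winners :: "'a set \<Rightarrow> 'a diagram \<Rightarrow> 'a set" where
  "winners A F = {y \<in> A. cycle_dominated F y \<or> not_dominated F y}"

text \<open>
  The list \<open>es\<close> enumerates \<open>E\<close> by decreasing margin, edges of equal margin being ordered by
  \<open>rank\<close>.  An injective \<open>rank\<close> prescribes any desired tie-breaking; a constant \<open>rank\<close> imposes
  no condition on ties at all.
\<close>

definition processing_order ::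
  "('a \<times> 'a \<Rightarrow> int) \<Rightarrow> ('a \<times> 'a) set \<Rightarrow> ('a \<times> 'a \<Rightarrow> int) \<Rightarrow> ('a \<times> 'a) list \<Rightarrow> bool" where
  "processing_order m E rank es \<longleftrightarrow>
     distinct es \<and> set es = E \<and>
     sorted_wrt (\<lambda>e f. m e > m f \<or> m e = m f \<and> rank e \<le> rank f) es"


section \<open>A random access machine with unit costs\<close>

text \<open>
  While programs over finitely many integer arrays (a scalar is an array used at one index only).
  Arithmetic is restricted to addition and subtraction: with these, numbers grow by at most one
  bit per operation, so that unit costs are a realistic measure, whereas unit-cost multiplication
  would not be.  Every syntax node that is evaluated costs one unit of time.
\<close>

type_synonym vname = string
type_synonym state = "vname \<Rightarrow> int \<Rightarrow> int"

datatype aexp = Const int | Get vname aexp | Add aexp aexp | Sub aexp aexp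
datatype bexp = Less aexp aexp | Neg bexp | Conj bexp bexp
datatype com = Skip | Put vname aexp aexp | Seq com com | Cond bexp com com | While bexp com

fun aval :: "aexp \<Rightarrow> state \<Rightarrow> int" where
  "aval (Const z) s = z"
| "aval (Get a e) s = s a (aval e s)"
| "aval (Add e f) s = aval e s + aval f s"
| "aval (Sub e f) s = aval e s - aval f s"

fun acost :: "aexp \<Rightarrow> nat" where
  "acost (Const z) = 1"
| "acost (Get a e) = 1 + acost e"
| "acost (Add e f) = 1 + acost e + acost f"
| "acost (Sub e f) = 1 + acost e + acost f"

fun bval :: "bexp \<Rightarrow> state \<Rightarrow> bool" where
  "bval (Less e f) s \<longleftrightarrow> aval e s < aval f s"
| "bval (Neg b) s \<longleftrightarrow> \<not> bval b s"
| "bval (Conj b c) s \<longleftrightarrow> bval b s \<and> bval c s"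

fun bcost :: "bexp \<Rightarrow> nat" where
  "bcost (Less e f) = 1 + acost e + acost f"
| "bcost (Neg b) = 1 + bcost b"
| "bcost (Conj b c) = 1 + bcost b + bcost c"

text \<open>\<open>exec c s t s'\<close>: started in \<open>s\<close>, program \<open>c\<close> halts after \<open>t\<close> time units in state \<open>s'\<close>.\<close>

inductive exec :: "com \<Rightarrow> state \<Rightarrow> nat \<Rightarrow> state \<Rightarrow> bool" where
  Skip: "exec Skip s 1 s"
| Put: "exec (Put a i e) s (1 + acost i + acost e) (s(a := (s a)(aval i s := aval e s)))"
| Seq: "exec c s t s' \<Longrightarrow> exec d s' t' s'' \<Longrightarrow> exec (Seq c d) s (1 + t + t') s''"
| CondTrue: "bval b s \<Longrightarrow> exec c s t s' \<Longrightarrow> exec (Cond b c d) s (1 + bcost b + t) s'"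
| CondFalse: "\<not> bval b s \<Longrightarrow> exec d s t s' \<Longrightarrow> exec (Cond b c d) s (1 + bcost b + t) s'"
| WhileFalse: "\<not> bval b s \<Longrightarrow> exec (While b c) s (1 + bcost b) s"
| WhileTrue: "bval b s \<Longrightarrow> exec c s t s' \<Longrightarrow> exec (While b c) s' t' s'' \<Longrightarrow>
    exec (While b c) s (1 + bcost b + t + t') s''"

inductive_cases exec_SkipE: "exec Skip s t s'"
inductive_cases exec_PutE: "exec (Put a i e) s t s'"
inductive_cases exec_SeqE: "exec (Seq c d) s t s'"
inductive_cases exec_CondE: "exec (Cond b c d) s t s'"
inductive_cases exec_WhileE: "exec (While b c) s t s'"

text \<open>Since programs are deterministic, the existence of a run determines time and result.\<close>

lemma exec_deterministic:
  "exec c s t s' \<Longrightarrow> exec c s r u \<Longrightarrow> t = r \<and> s' = u"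
proof (induction arbitrary: r u rule: exec.induct)
  case Skip then show ?case by (auto elim: exec_SkipE)
next
  case Put then show ?case by (auto elim: exec_PutE)
next
  case (Seq c s t s' d t' s'')
  from Seq.prems obtain t1 u1 t2 where
    "exec c s t1 u1" "exec d u1 t2 u" "r = 1 + t1 + t2" by (auto elim: exec_SeqE)
  with Seq.IH show ?case by metis
next
  case (CondTrue b s c t s' d)
  from CondTrue.prems CondTrue.hyps(1) obtain t1 where
    "exec c s t1 u" "r = 1 + bcost b + t1" by (auto elim: exec_CondE)
  with CondTrue.IH show ?case by metis
next
  case (CondFalse b s d t s' c)
  from CondFalse.prems CondFalse.hyps(1) obtain t1 where
    "exec d s t1 u" "r = 1 + bcost b + t1" by (auto elim: exec_CondE)
  with CondFalse.IH show ?case by metis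
next
  case WhileFalse then show ?case by (auto elim: exec_WhileE)
next
  case (WhileTrue b s c t s' t' s'')
  from WhileTrue.prems WhileTrue.hyps(1) obtain t1 u1 t2 where
    "exec c s t1 u1" "exec (While b c) u1 t2 u" "r = 1 + bcost b + t1 + t2"
    by (auto elim: exec_WhileE)
  with WhileTrue.IH show ?case by metis
qed


section \<open>Input and output\<close>

text \<open>
  The alternatives are numbered by a bijection \<open>v\<close> from \<open>{..<card A}\<close> to \<open>A\<close>; \<open>adj i\<close> is the
  adjacency list of vertex number \<open>i\<close>, listing the heads of its outgoing edges in any order.
\<close>

definition adjacency_lists ::
  "'a set \<Rightarrow> ('a \<times> 'a) set \<Rightarrow> (nat \<Rightarrow> 'a) \<Rightarrow> (nat \<Rightarrow> nat list) \<Rightarrow> bool" where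
  "adjacency_lists A E v adj \<longleftrightarrow>
     bij_betw v {..<card A} A \<and>
     (\<forall>i < card A. distinct (adj i) \<and> set (adj i) = {j. j < card A \<and> (v i, v j) \<in> E})"

definition along_adj :: "nat \<Rightarrow> (nat \<Rightarrow> nat list) \<Rightarrow> (nat \<Rightarrow> nat \<Rightarrow> 'b) \<Rightarrow> 'b list" where
  "along_adj n adj f = concat (map (\<lambda>i. map (f i) (adj i)) [0..<n])"

definition array_of :: "int list \<Rightarrow> int \<Rightarrow> int" where
  "array_of xs i = (if 0 \<le> i \<and> nat i < length xs then xs ! nat i else 0)"

text \<open>
  The adjacency lists are stored one after the other: that of vertex \<open>i\<close> occupies the positions
  from \<open>off[i]\<close> up to, but not including, \<open>off[i + 1]\<close> of the arrays \<open>head\<close> and \<open>weight\<close>.  The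
  tie-breaking ranks are stored likewise.  All other memory is zero; hence a constantly zero
  \<open>rank\<close> means that the margin graph is the only input.
\<close>

definition input_state ::
  "nat \<Rightarrow> (nat \<Rightarrow> 'a) \<Rightarrow> (nat \<Rightarrow> nat list) \<Rightarrow> ('a \<times> 'a \<Rightarrow> int) \<Rightarrow> ('a \<times> 'a \<Rightarrow> int) \<Rightarrow> state" where
  "input_state n v adj m rank = (\<lambda>_ _. 0)
     (''n'' := array_of [int n],
      ''off'' := array_of (map (\<lambda>i. \<Sum>l<i. int (length (adj l))) [0..<Suc n]),
      ''head'' := array_of (along_adj n adj (\<lambda>i j. int j)),
      ''weight'' := array_of (along_adj n adj (\<lambda>i j. m (v i, v j))),
      ''rank'' := array_of (along_adj n adj (\<lambda>i j. rank (v i, v j))))"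

fun state_code :: "estate option \<Rightarrow> int" where
  "state_code None = 0"
| "state_code (Some Fix) = 1"
| "state_code (Some BC) = 2"
| "state_code (Some CC) = 3"
| "state_code (Some CBC) = 4"

definition outputs_diagram ::
  "nat \<Rightarrow> (nat \<Rightarrow> 'a) \<Rightarrow> (nat \<Rightarrow> nat list) \<Rightarrow> state \<Rightarrow> 'a diagram \<Rightarrow> bool" where
  "outputs_diagram n v adj s F \<longleftrightarrow>
     (let cs = along_adj n adj (\<lambda>i j. state_code (F (v i, v j)))
      in \<forall>q < length cs. s ''state'' (int q) = cs ! q)"

definition outputs_set :: "nat \<Rightarrow> (nat \<Rightarrow> 'a) \<Rightarrow> state \<Rightarrow> 'a set \<Rightarrow> bool" where
  "outputs_set n v s W \<longleftrightarrow>
     (\<forall>i < n. s ''winner'' (int i) = (if v i \<in> W then 1 else 0))"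

end

theory Submission
  imports Defs "HOL-Library.Product_Lexorder"
begin

text \<open>
  Paths, over which the algorithm quantifies, can be replaced by reachability: some path from \<open>u\<close> to
  \<open>w\<close> uses only edges with a given property iff \<open>w\<close> is reachable from \<open>u\<close> by such edges. In
  particular, a path in the second rejection rule for \<open>(x, y)\<close> may use an edge \<open>(c, d)\<close> of state \<open>CC\<close>
  iff \<open>d = y\<close> or \<open>c\<close> is not reachable from \<open>d\<close> by edges of margin at least \<open>m (c, d)\<close> that avoid \<open>y\<close>.
  Hence the state that an edge receives in an iteration is determined by a property of the current
  diagram that is built from comparisons of margins and states by means of Boolean connectives,
  quantification over vertices, and reachability. Every such property is decided in polynomial time
  by nested loops over the vertices, and there are at most as many iterations as pairs of vertices.
\<close>


section \<open>Polynomial-time Hoare logic\<close>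

definition input_size :: "state \<Rightarrow> nat" where
  "input_size s = nat (s ''n'' 0)"

text \<open>The logical variable \<open>x\<close> relates the postcondition to the precondition.\<close>

definition polytime :: "('x \<Rightarrow> state \<Rightarrow> bool) \<Rightarrow> com \<Rightarrow> ('x \<Rightarrow> state \<Rightarrow> bool) \<Rightarrow> bool" where
  "polytime P c Q \<longleftrightarrow> (\<exists>T :: nat poly. \<forall>x s. P x s \<longrightarrow>
     (\<exists>t s'. exec c s t s' \<and> t \<le> poly T (input_size s) \<and> s' ''n'' = s ''n'' \<and> Q x s'))"

lemma polytimeI:
  fixes T :: "nat poly"
  assumes "\<And>x s. P x s \<Longrightarrow>
    \<exists>t s'. exec c s t s' \<and> t \<le> poly T (input_size s) \<and> s' ''n'' = s ''n'' \<and> Q x s'"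
  shows "polytime P c Q"
  using assms unfolding polytime_def by blast

lemma polytimeE:
  assumes "polytime P c Q"
  obtains T :: "nat poly" where "\<And>x s. P x s \<Longrightarrow>
    \<exists>t s'. exec c s t s' \<and> t \<le> poly T (input_size s) \<and> s' ''n'' = s ''n'' \<and> Q x s'"
  using assms unfolding polytime_def by blast

lemma polytime_conseq:
  assumes "polytime P c Q"
    and "\<And>y s. P' y s \<Longrightarrow> \<exists>x. P x s \<and> (\<forall>s'. s' ''n'' = s ''n'' \<longrightarrow> Q x s' \<longrightarrow> Q' y s')"
  shows "polytime P' c Q'"
  using assms unfolding polytime_def by metis

lemma polytime_pre:
  "polytime P c Q \<Longrightarrow> (\<And>x s. P' x s \<Longrightarrow> P x s) \<Longrightarrow> polytime P' c Q"
  by (erule polytime_conseq) blast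

lemma polytime_post:
  "polytime P c Q \<Longrightarrow> (\<And>x s. Q x s \<Longrightarrow> Q' x s) \<Longrightarrow> polytime P c Q'"
  by (erule polytime_conseq) blast

lemma polytime_Skip: "(\<And>x s. P x s \<Longrightarrow> Q x s) \<Longrightarrow> polytime P Skip Q"
  by (rule polytimeI[where T = 1]) (use exec.Skip in fastforce)

lemma polytime_Put:
  assumes "a \<noteq> ''n''" and "\<And>x s. P x s \<Longrightarrow> Q x (s(a := (s a)(aval i s := aval e s)))"
  shows "polytime P (Put a i e) Q"
proof (rule polytimeI)
  fix x s assume "P x s"
  with assms have "(s(a := (s a)(aval i s := aval e s))) ''n'' = s ''n''"
    and "Q x (s(a := (s a)(aval i s := aval e s)))" by simp_all
  moreover have "1 + acost i + acost e \<le> poly [:1 + acost i + acost e:] (input_size s)" by simp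
  ultimately show "\<exists>t s'. exec (Put a i e) s t s' \<and>
      t \<le> poly [:1 + acost i + acost e:] (input_size s) \<and> s' ''n'' = s ''n'' \<and> Q x s'"
    using exec.Put by blast
qed

lemma polytime_Seq:
  assumes "polytime P c Q" and "polytime Q d R"
  shows "polytime P (Seq c d) R"
proof -
  obtain T where T: "\<And>x s. P x s \<Longrightarrow>
      \<exists>t s'. exec c s t s' \<and> t \<le> poly T (input_size s) \<and> s' ''n'' = s ''n'' \<and> Q x s'"
    using assms(1) by (rule polytimeE) blast
  obtain U where U: "\<And>x s. Q x s \<Longrightarrow>
      \<exists>t s'. exec d s t s' \<and> t \<le> poly U (input_size s) \<and> s' ''n'' = s ''n'' \<and> R x s'"
    using assms(2) by (rule polytimeE) blast
  show ?thesis
  proof (rule polytimeI)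
    fix x s assume "P x s"
    from T[OF this] obtain t s' where c: "exec c s t s'" "t \<le> poly T (input_size s)"
      "s' ''n'' = s ''n''" "Q x s'" by blast
    from U[OF c(4)] obtain t' s'' where d: "exec d s' t' s''" "t' \<le> poly U (input_size s')"
      "s'' ''n'' = s' ''n''" "R x s''" by blast
    have "1 + t + t' \<le> poly (1 + T + U) (input_size s)"
      using c d by (simp add: input_size_def)
    with exec.Seq[OF c(1) d(1)] c d
    show "\<exists>t s'. exec (Seq c d) s t s' \<and> t \<le> poly (1 + T + U) (input_size s) \<and>
        s' ''n'' = s ''n'' \<and> R x s'" by metis
  qed
qed

lemma polytime_Cond:
  assumes "polytime (\<lambda>x s. P x s \<and> bval b s) c Q" and "polytime (\<lambda>x s. P x s \<and> \<not> bval b s) d Q"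
  shows "polytime P (Cond b c d) Q"
proof -
  obtain T where T: "\<And>x s. P x s \<and> bval b s \<Longrightarrow>
      \<exists>t s'. exec c s t s' \<and> t \<le> poly T (input_size s) \<and> s' ''n'' = s ''n'' \<and> Q x s'"
    using assms(1) by (rule polytimeE) blast
  obtain U where U: "\<And>x s. P x s \<and> \<not> bval b s \<Longrightarrow>
      \<exists>t s'. exec d s t s' \<and> t \<le> poly U (input_size s) \<and> s' ''n'' = s ''n'' \<and> Q x s'"
    using assms(2) by (rule polytimeE) blast
  have "\<exists>t s'. exec (Cond b c d) s (1 + bcost b + t) s' \<and>
      t \<le> poly T (input_size s) + poly U (input_size s) \<and> s' ''n'' = s ''n'' \<and> Q x s'"
    if "P x s" for x s
  proof (cases "bval b s")
    case True
    with T that obtain t s' where "exec c s t s'"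
      "t \<le> poly T (input_size s)" "s' ''n'' = s ''n''" "Q x s'" by blast
    with exec.CondTrue[OF True] show ?thesis by (metis trans_le_add1)
  next
    case False
    with U that obtain t s' where "exec d s t s'"
      "t \<le> poly U (input_size s)" "s' ''n'' = s ''n''" "Q x s'" by blast
    with exec.CondFalse[OF False] show ?thesis by (metis trans_le_add2)
  qed
  then show ?thesis
    by (intro polytimeI[where T = "[:1 + bcost b:] + T + U"]) fastforce
qed

lemma polytime_Cond_Skip:
  assumes "polytime (\<lambda>x s. P x s \<and> bval b s) c Q" and "\<And>x s. P x s \<Longrightarrow> \<not> bval b s \<Longrightarrow> Q x s"
  shows "polytime P (Cond b c Skip) Q"
  using assms by (intro polytime_Cond polytime_Skip) auto

definition index :: "nat \<Rightarrow> aexp" where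
  "index k = Get ''i'' (Const (int k))"

definition set_index :: "nat \<Rightarrow> nat \<Rightarrow> state \<Rightarrow> state" where
  "set_index k j s = s(''i'' := (s ''i'')(int k := int j))"

lemma set_index_simps [simp]:
  "a \<noteq> ''i'' \<Longrightarrow> set_index k j s a = s a"
  "set_index k j s ''i'' z = (if z = int k then int j else s ''i'' z)"
  "input_size (set_index k j s) = input_size s"
  by (auto simp: set_index_def input_size_def)

lemma aval_index [simp]: "aval (index k) s = s ''i'' (int k)"
  by (simp add: index_def)

definition for_loop :: "nat \<Rightarrow> com \<Rightarrow> com" where
  "for_loop k c = Seq (Put ''i'' (Const (int k)) (Const 0))
     (While (Less (index k) (Get ''n'' (Const 0)))
       (Seq c (Put ''i'' (Const (int k)) (Add (index k) (Const 1)))))"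

lemma exec_counting_While:
  assumes body: "\<And>j s. I j s \<Longrightarrow> j < n \<Longrightarrow>
      \<exists>t s'. exec c s t s' \<and> t \<le> T \<and> I (Suc j) s'"
    and guard: "\<And>j s. I j s \<Longrightarrow> bval b s \<longleftrightarrow> j < n"
    and "I j s" "j \<le> n"
  shows "\<exists>t s'. exec (While b c) s t s' \<and> t \<le> 1 + bcost b + (n - j) * (1 + bcost b + T) \<and> I n s'"
  using assms(3,4)
proof (induction "n - j" arbitrary: j s)
  case 0
  then have "j = n" by simp
  with guard[OF 0(2)] have "exec (While b c) s (1 + bcost b) s"
    by (intro exec.WhileFalse) simp
  with 0 \<open>j = n\<close> show ?case by auto
next
  case (Suc l)
  then have "j < n" by simp
  with body Suc.prems obtain t s' where c: "exec c s t s'" "t \<le> T" "I (Suc j) s'" by blast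
  with Suc.hyps(1)[of "Suc j" s'] Suc.hyps(2) \<open>j < n\<close> obtain t' s'' where
    loop: "exec (While b c) s' t' s''" "t' \<le> 1 + bcost b + (n - Suc j) * (1 + bcost b + T)"
      "I n s''"
    by fastforce
  have "exec (While b c) s (1 + bcost b + t + t') s''"
    using guard \<open>j < n\<close> Suc.prems(1) c(1) loop(1) by (blast intro: exec.WhileTrue)
  moreover have "n - j = Suc (n - Suc j)" using \<open>j < n\<close> by simp
  then have "1 + bcost b + t + t' \<le> 1 + bcost b + (n - j) * (1 + bcost b + T)"
    using c(2) loop(2) by simp
  ultimately show ?case using loop(3) by blast
qed

lemma polytime_counting_While:
  assumes body: "polytime (\<lambda>(x, j) s. I x j s \<and> j < input_size s) c (\<lambda>(x, j). I x (Suc j))"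
    and guard: "\<And>x j s. I x j s \<Longrightarrow> bval b s \<longleftrightarrow> j < input_size s"
  shows "polytime (\<lambda>x. I x 0) (While b c) (\<lambda>x s. I x (input_size s) s)"
proof -
  obtain T where T: "\<And>x j s. I x j s \<Longrightarrow> j < input_size s \<Longrightarrow>
      \<exists>t s'. exec c s t s' \<and> t \<le> poly T (input_size s) \<and> s' ''n'' = s ''n'' \<and> I x (Suc j) s'"
    using body by (rule polytimeE) force
  show ?thesis
  proof (rule polytimeI)
    fix x s assume "I x 0 s"
    define n where "n = input_size s"
    have "\<exists>t s'. exec (While b c) s t s' \<and> t \<le> 1 + bcost b + (n - 0) * (1 + bcost b + poly T n) \<and>
        I x n s' \<and> s' ''n'' = s ''n''"
    proof (rule exec_counting_While[where I = "\<lambda>j s'. I x j s' \<and> s' ''n'' = s ''n''"])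
      fix j s' assume I: "I x j s' \<and> s' ''n'' = s ''n''"
      then have n: "input_size s' = n" by (simp add: n_def input_size_def)
      with I guard show "bval b s' \<longleftrightarrow> j < n" by metis
      assume "j < n"
      with T[of x j s'] I n show "\<exists>t s''. exec c s' t s'' \<and> t \<le> poly T n \<and>
          I x (Suc j) s'' \<and> s'' ''n'' = s ''n''" by metis
    qed (use \<open>I x 0 s\<close> in simp_all)
    then show "\<exists>t s'. exec (While b c) s t s' \<and>
        t \<le> poly ([:1 + bcost b:] + [:0, 1:] * ([:1 + bcost b:] + T)) (input_size s) \<and>
        s' ''n'' = s ''n'' \<and> I x (input_size s') s'"
      by (force simp: n_def input_size_def)
  qed
qed

lemma polytime_for_loop:
  assumes body: "polytime (\<lambda>(x, j) s. I x j s \<and> j < input_size s \<and> s ''i'' (int k) = int j) c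
      (\<lambda>(x, j) s. I x (Suc j) s \<and> s ''i'' (int k) = int j)"
    and frame: "\<And>x j l s. I x j s \<Longrightarrow> I x j (set_index k l s)"
  shows "polytime (\<lambda>x. I x 0) (for_loop k c) (\<lambda>x s. I x (input_size s) s)"
proof -
  define b where "b = Less (index k) (Get ''n'' (Const 0))"
  define inc where "inc = Put ''i'' (Const (int k)) (Add (index k) (Const 1))"
  define J where "J = (\<lambda>x j s. I x j s \<and> s ''i'' (int k) = int j)"
  have "polytime (\<lambda>(x, j) s. J x j s \<and> j < input_size s) (Seq c inc) (\<lambda>(x, j). J x (Suc j))"
    unfolding inc_def J_def
    by (rule polytime_Seq[OF polytime_pre[OF body] polytime_Put])
      (use frame[of _ "Suc _" _ "Suc _"] in \<open>auto simp: set_index_def add.commute\<close>)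
  then have loop: "polytime (\<lambda>x. J x 0) (While b (Seq c inc)) (\<lambda>x s. J x (input_size s) s)"
    by (rule polytime_counting_While) (auto simp: J_def b_def input_size_def)
  have "polytime (\<lambda>x. I x 0) (for_loop k c) (\<lambda>x s. J x (input_size s) s)"
    unfolding for_loop_def b_def[symmetric] inc_def[symmetric]
    by (rule polytime_Seq[OF polytime_Put loop])
      (use frame[of _ 0 _ 0] in \<open>auto simp: J_def set_index_def\<close>)
  then show ?thesis by (rule polytime_post) (simp add: J_def)
qed


section \<open>Labelled graphs in memory\<close>

text \<open>
  The labels in the arrays \<open>matrices\<close> are stored row by row. As the machine cannot multiply, the
  position of the first entry of a row is looked up in the array \<open>''row''\<close>.
\<close>

record 'a labelled_graph =
  num_vertices :: nat
  vertex :: "nat \<Rightarrow> 'a"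
  label :: "vname \<Rightarrow> 'a \<times> 'a \<Rightarrow> int"

definition vertices :: "'a labelled_graph \<Rightarrow> 'a set" where
  "vertices G = vertex G ` {..<num_vertices G}"

definition well_numbered :: "'a labelled_graph \<Rightarrow> bool" where
  "well_numbered G \<longleftrightarrow> inj_on (vertex G) {..<num_vertices G}"

definition number :: "'a labelled_graph \<Rightarrow> 'a \<Rightarrow> nat" where
  "number G = the_inv_into {..<num_vertices G} (vertex G)"

definition cell :: "'a labelled_graph \<Rightarrow> 'a \<Rightarrow> 'a \<Rightarrow> nat" where
  "cell G u w = number G u * num_vertices G + number G w"

definition matrices :: "vname set" where
  "matrices = {''W'', ''R'', ''S''}"

lemma finite_vertices [simp]: "finite (vertices G)"
  by (simp add: vertices_def)

lemma number_vertex [simp]: "well_numbered G \<Longrightarrow> i < num_vertices G \<Longrightarrow> number G (vertex G i) = i"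
  by (simp add: number_def well_numbered_def the_inv_into_f_f)

lemma number_less: "well_numbered G \<Longrightarrow> u \<in> vertices G \<Longrightarrow> number G u < num_vertices G"
  by (auto simp: vertices_def)

lemma number_eq_iff:
  "well_numbered G \<Longrightarrow> u \<in> vertices G \<Longrightarrow> w \<in> vertices G \<Longrightarrow> number G u = number G w \<longleftrightarrow> u = w"
  by (auto simp: vertices_def)

lemma row_column_eq_iff:
  fixes i j k l n :: nat
  assumes "j < n" "l < n"
  shows "i * n + j = k * n + l \<longleftrightarrow> i = k \<and> j = l"
proof
  assume eq: "i * n + j = k * n + l"
  from arg_cong[OF eq, of "\<lambda>z. z div n"] arg_cong[OF eq, of "\<lambda>z. z mod n"] assms
  show "i = k \<and> j = l" by simp
qed simp

lemma cell_eq_iff: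
  assumes "well_numbered G"
    and "u \<in> vertices G" "w \<in> vertices G" "u' \<in> vertices G" "w' \<in> vertices G"
  shows "cell G u w = cell G u' w' \<longleftrightarrow> u = u' \<and> w = w'"
  using assms by (simp add: cell_def row_column_eq_iff number_less number_eq_iff)

definition laid_out :: "'a labelled_graph \<Rightarrow> state \<Rightarrow> bool" where
  "laid_out G s \<longleftrightarrow> well_numbered G \<and> s ''n'' 0 = int (num_vertices G) \<and>
     (\<forall>i<num_vertices G. s ''row'' (int i) = int (i * num_vertices G))"

definition stores :: "'a labelled_graph \<Rightarrow> state \<Rightarrow> bool" where
  "stores G s \<longleftrightarrow> laid_out G s \<and>
     (\<forall>a\<in>matrices. \<forall>u\<in>vertices G. \<forall>w\<in>vertices G. s a (int (cell G u w)) = label G a (u, w))"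

definition at_vertex :: "'a labelled_graph \<Rightarrow> nat \<Rightarrow> 'a \<Rightarrow> state \<Rightarrow> bool" where
  "at_vertex G k u s \<longleftrightarrow> u \<in> vertices G \<and> s ''i'' (int k) = int (number G u)"

definition represents :: "nat \<Rightarrow> 'a labelled_graph \<Rightarrow> (nat \<Rightarrow> 'a) \<Rightarrow> state \<Rightarrow> bool" where
  "represents d G \<rho> s \<longleftrightarrow> stores G s \<and> (\<forall>k<d. at_vertex G k (\<rho> k) s)"

definition valuation :: "nat \<Rightarrow> 'a labelled_graph \<Rightarrow> (nat \<Rightarrow> 'a) \<Rightarrow> bool" where
  "valuation d G \<rho> \<longleftrightarrow> well_numbered G \<and> (\<forall>k<d. \<rho> k \<in> vertices G)"

lemma storesD:
  "stores G s \<Longrightarrow> a \<in> matrices \<Longrightarrow> u \<in> vertices G \<Longrightarrow> w \<in> vertices G \<Longrightarrow>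
    s a (int (cell G u w)) = label G a (u, w)"
  by (simp add: stores_def)

lemma stores_laid_out: "stores G s \<Longrightarrow> laid_out G s"
  by (simp add: stores_def)

lemma laid_out_well_numbered: "laid_out G s \<Longrightarrow> well_numbered G"
  by (simp add: laid_out_def)

lemma laid_out_input_size: "laid_out G s \<Longrightarrow> input_size s = num_vertices G"
  by (simp add: laid_out_def input_size_def)

lemma represents_stores: "represents d G \<rho> s \<Longrightarrow> stores G s"
  by (simp add: represents_def)

lemma represents_laid_out: "represents d G \<rho> s \<Longrightarrow> laid_out G s"
  by (simp add: represents_def stores_def)

lemma represents_at_vertex: "represents d G \<rho> s \<Longrightarrow> k < d \<Longrightarrow> at_vertex G k (\<rho> k) s"
  by (simp add: represents_def)

lemma represents_valuation: "represents d G \<rho> s \<Longrightarrow> valuation d G \<rho>"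
  by (simp add: represents_def valuation_def at_vertex_def stores_def laid_out_def)

lemma represents_Suc:
  "represents d G \<rho> s \<Longrightarrow> at_vertex G d u s \<Longrightarrow> represents (Suc d) G (\<rho>(d := u)) s"
  by (simp add: represents_def less_Suc_eq)

lemma represents_SucD: "represents (Suc d) G (\<rho>(d := u)) s \<Longrightarrow> represents d G \<rho> s"
  unfolding represents_def by (metis fun_upd_other less_SucI less_irrefl)

lemma at_vertex_in: "at_vertex G k u s \<Longrightarrow> u \<in> vertices G"
  by (simp add: at_vertex_def)

lemma aval_index_at_vertex: "at_vertex G k u s \<Longrightarrow> aval (index k) s = int (number G u)"
  by (simp add: at_vertex_def)

lemma at_vertex_upd [simp]: "a \<noteq> ''i'' \<Longrightarrow> at_vertex G k u (s(a := f)) \<longleftrightarrow> at_vertex G k u s"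
  by (simp add: at_vertex_def)

lemma at_vertex_set_index [simp]:
  "k \<noteq> l \<Longrightarrow> at_vertex G k u (set_index l j s) \<longleftrightarrow> at_vertex G k u s"
  by (simp add: at_vertex_def)

text \<open>
  Programs at depth \<open>d\<close> find vertices in the index registers below \<open>d\<close> and may overwrite the other
  index registers and the arrays \<open>scratch k\<close> with \<open>k \<ge> d\<close>.
\<close>

definition scratch :: "nat \<Rightarrow> vname" where
  "scratch d = ''scratch'' @ replicate d (CHR ''x'')"

definition unchanged :: "nat \<Rightarrow> vname set \<Rightarrow> state \<Rightarrow> state \<Rightarrow> bool" where
  "unchanged d X s s' \<longleftrightarrow>
     (\<forall>a. a \<notin> X \<union> {''i'', ''res''} \<union> scratch ` {d..} \<longrightarrow> s' a = s a) \<and>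
     (\<forall>k<d. s' ''i'' (int k) = s ''i'' (int k))"

lemma scratch_eq_iff [simp]: "scratch d = scratch d' \<longleftrightarrow> d = d'"
  by (simp add: scratch_def)

lemma scratch_neq [simp]:
  "scratch d \<noteq> ''n''" "scratch d \<noteq> ''row''" "scratch d \<noteq> ''i''" "scratch d \<noteq> ''res''"
  by (simp_all add: scratch_def)

lemmas scratch_neq_sym [simp] = scratch_neq[symmetric]

lemma notin_scratch [simp]:
  "''n'' \<notin> scratch ` D" "''row'' \<notin> scratch ` D" "''state'' \<notin> scratch ` D" "''winner'' \<notin> scratch ` D"
  "''off'' \<notin> scratch ` D" "''head'' \<notin> scratch ` D" "''weight'' \<notin> scratch ` D"
  "''rank'' \<notin> scratch ` D"
  by (auto simp: scratch_def)

lemma notin_matrices [simp]: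
  "scratch k \<notin> matrices" "''n'' \<notin> matrices" "''row'' \<notin> matrices" "''i'' \<notin> matrices"
  "''res'' \<notin> matrices" "''state'' \<notin> matrices" "''winner'' \<notin> matrices"
  by (auto simp: matrices_def scratch_def)

lemma matrices_notin_scratch [simp]: "a \<in> matrices \<Longrightarrow> a \<notin> scratch ` D"
  by auto

lemma unchanged_refl [simp]: "unchanged d X s s"
  by (simp add: unchanged_def)

lemma unchanged_trans:
  "unchanged d X s s' \<Longrightarrow> unchanged d X s' s'' \<Longrightarrow> unchanged d X s s''"
  by (simp add: unchanged_def)

lemma unchanged_arrayD:
  "unchanged d X s s' \<Longrightarrow> a \<notin> X \<union> {''i'', ''res''} \<union> scratch ` {d..} \<Longrightarrow> s' a = s a"
  unfolding unchanged_def by blast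

lemma unchanged_mono:
  assumes "unchanged d X s s'" "d' \<le> d" "X \<subseteq> Y"
  shows "unchanged d' Y s s'"
proof -
  have "X \<union> {''i'', ''res''} \<union> scratch ` {d..} \<subseteq> Y \<union> {''i'', ''res''} \<union> scratch ` {d'..}"
    using assms(2,3) by auto
  then show ?thesis
    using unchanged_arrayD[OF assms(1)] assms(1,2)
    unfolding unchanged_def by (meson less_le_trans subsetD)
qed

lemma unchanged_SucD: "unchanged (Suc d) {scratch d} s s' \<Longrightarrow> unchanged d {} s s'"
proof -
  have "{d..} = insert d {Suc d..}" by auto
  then show "unchanged (Suc d) {scratch d} s s' \<Longrightarrow> unchanged d {} s s'"
    unfolding unchanged_def by simp
qed

lemma unchanged_upd:
  "unchanged d X s s' \<Longrightarrow> a \<in> X \<union> {''res''} \<union> scratch ` {d..} \<Longrightarrow> a \<noteq> ''i'' \<Longrightarrow>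
    unchanged d X s (s'(a := f))"
  by (auto simp: unchanged_def)

lemma unchanged_set_index [simp]:
  "d \<le> k \<Longrightarrow> unchanged d X s (set_index k j s') \<longleftrightarrow> unchanged d X s s'"
  by (auto simp: unchanged_def)

lemma unchanged_scratchD:
  "unchanged d X s s' \<Longrightarrow> k < d \<Longrightarrow> scratch k \<notin> X \<Longrightarrow> s' (scratch k) = s (scratch k)"
  by (rule unchanged_arrayD) auto

lemma unchanged_at_vertex:
  "unchanged d X s s' \<Longrightarrow> k < d \<Longrightarrow> at_vertex G k u s' \<longleftrightarrow> at_vertex G k u s"
  by (simp add: unchanged_def at_vertex_def)

lemma unchanged_laid_out:
  assumes "unchanged d X s s'" "laid_out G s" "X \<inter> {''n'', ''row''} = {}"
  shows "laid_out G s'"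
  using assms unchanged_arrayD[OF assms(1), of "''n''"] unchanged_arrayD[OF assms(1), of "''row''"]
  by (simp add: laid_out_def)

lemma unchanged_stores:
  assumes "unchanged d X s s'" "stores G s" "X \<inter> ({''n'', ''row''} \<union> matrices) = {}"
  shows "stores G s'"
proof -
  have "s' a = s a" if "a \<in> matrices" for a
    by (rule unchanged_arrayD[OF assms(1)]) (use that assms(3) in auto)
  moreover have "laid_out G s'"
    using assms by (intro unchanged_laid_out[OF assms(1)]) (auto simp: stores_def)
  ultimately show ?thesis using assms(2) by (simp add: stores_def)
qed

lemma unchanged_represents:
  assumes "unchanged d X s s'" "represents d G \<rho> s" "X \<inter> ({''n'', ''row''} \<union> matrices) = {}"
  shows "represents d G \<rho> s'"
  using assms unchanged_stores[OF assms(1), of G]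
  by (simp add: represents_def unchanged_at_vertex[OF assms(1)])

lemma polytime_for_vertices:
  fixes G :: "'x \<Rightarrow> 'a labelled_graph"
  assumes body: "polytime
      (\<lambda>(x, U, u) s. I x U s \<and> U \<subseteq> vertices (G x) \<and> u \<notin> U \<and> at_vertex (G x) k u s) c
      (\<lambda>(x, U, u) s. I x (insert u U) s \<and> at_vertex (G x) k u s)"
    and layout: "\<And>x U s. I x U s \<Longrightarrow> laid_out (G x) s"
    and frame: "\<And>x U j s. I x U s \<Longrightarrow> I x U (set_index k j s)"
  shows "polytime (\<lambda>x. I x {}) (for_loop k c) (\<lambda>x. I x (vertices (G x)))"
proof -
  define J where "J = (\<lambda>x j. I x (vertex (G x) ` {..<j}))"
  have "polytime (\<lambda>x. J x 0) (for_loop k c) (\<lambda>x s. J x (input_size s) s)"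
  proof (rule polytime_for_loop[OF polytime_conseq[OF body]], goal_cases)
    case (1 y s)
    obtain x j where y: "y = (x, j)" by (cases y)
    with 1 have "laid_out (G x) s" by (auto simp: J_def dest: layout)
    with 1 have G: "well_numbered (G x)" and j: "j < num_vertices (G x)" "s ''i'' (int k) = int j"
      by (auto simp: y laid_out_well_numbered laid_out_input_size)
    have "vertex (G x) ` {..<j} \<subseteq> vertices (G x)" using j(1) by (auto simp: vertices_def)
    moreover have "vertex (G x) j \<notin> vertex (G x) ` {..<j}"
      using G j(1) inj_on_image_mem_iff[of "vertex (G x)" "{..<num_vertices (G x)}" j "{..<j}"]
      by (auto simp: well_numbered_def)
    moreover have "insert (vertex (G x) j) (vertex (G x) ` {..<j}) = vertex (G x) ` {..<Suc j}"
      by (simp add: lessThan_Suc)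
    ultimately show ?case
      using 1 G j
      by (intro exI[of _ "(x, vertex (G x) ` {..<j}, vertex (G x) j)"])
        (auto simp: y J_def at_vertex_def vertices_def)
  qed (simp add: J_def frame)
  then show ?thesis
  proof (rule polytime_pre[OF polytime_post])
    fix x s assume "J x (input_size s) s"
    then show "I x (vertices (G x)) s"
      using laid_out_input_size[of "G x" s] layout by (simp add: J_def vertices_def)
  qed (simp add: J_def)
qed

definition for_pairs :: "nat \<Rightarrow> com \<Rightarrow> com" where
  "for_pairs k c = for_loop k (for_loop (Suc k) c)"

lemma polytime_for_vertex_pairs:
  fixes G :: "'x \<Rightarrow> 'a labelled_graph"
  assumes body: "polytime (\<lambda>(x, E, u, w) s. I x E s \<and> E \<subseteq> vertices (G x) \<times> vertices (G x) \<and>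
        (u, w) \<notin> E \<and> at_vertex (G x) k u s \<and> at_vertex (G x) (Suc k) w s) c
      (\<lambda>(x, E, u, w) s. I x (insert (u, w) E) s \<and>
        at_vertex (G x) k u s \<and> at_vertex (G x) (Suc k) w s)"
    and layout: "\<And>x E s. I x E s \<Longrightarrow> laid_out (G x) s"
    and frame: "\<And>x E l j s. k \<le> l \<Longrightarrow> I x E s \<Longrightarrow> I x E (set_index l j s)"
  shows "polytime (\<lambda>x. I x {}) (for_pairs k c) (\<lambda>x. I x (vertices (G x) \<times> vertices (G x)))"
proof -
  define row where "row = (\<lambda>x U (u :: 'a) W. U \<times> vertices (G x) \<union> {u} \<times> W)"
  define J where "J = (\<lambda>(x, U, u) W s. I x (row x U u W) s \<and> U \<subseteq> vertices (G x) \<and> u \<notin> U \<and>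
    at_vertex (G x) k u s)"
  have "polytime (\<lambda>z. J z {}) (for_loop (Suc k) c) (\<lambda>z. J z (vertices (G (fst z))))"
  proof (rule polytime_for_vertices[OF polytime_conseq[OF body]], goal_cases)
    case (1 y s)
    obtain x U u W w where y: "y = ((x, U, u), W, w)" by (metis surj_pair)
    have "insert (u, w) (row x U u W) = row x U u (insert w W)" by (auto simp: row_def)
    moreover have "row x U u W \<subseteq> vertices (G x) \<times> vertices (G x) \<and> (u, w) \<notin> row x U u W"
      using 1 by (auto simp: y J_def row_def dest: at_vertex_in)
    ultimately show ?case
      using 1 by (intro exI[of _ "(x, row x U u W, u, w)"]) (auto simp: y J_def)
  qed (auto simp: J_def layout frame)
  then have "polytime (\<lambda>x. I x ({} \<times> vertices (G x))) (for_pairs k c)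
      (\<lambda>x. I x (vertices (G x) \<times> vertices (G x)))"
    unfolding for_pairs_def
  proof (rule polytime_for_vertices[where I = "\<lambda>x U. I x (U \<times> vertices (G x))", OF polytime_conseq],
      goal_cases)
    case (1 y s)
    obtain x U u where y: "y = (x, U, u)" by (rule prod_cases3)
    have "insert u U \<times> vertices (G x) = row x U u (vertices (G x))" by (auto simp: row_def)
    with 1 show ?case
      by (intro exI[of _ "(x, U, u)"]) (auto simp: y J_def row_def)
  qed (auto simp: layout frame)
  then show ?thesis by simp
qed


section \<open>Computable labels and decidable properties\<close>

text \<open>\<open>s0\<close> is the state in which the computation started.\<close>

definition intermediate ::
  "nat \<Rightarrow> 'a labelled_graph \<times> (nat \<Rightarrow> 'a) \<times> state \<Rightarrow> state \<Rightarrow> bool" where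
  "intermediate d = (\<lambda>(G, \<rho>, s0) s. represents d G \<rho> s \<and> unchanged d {} s0 s)"

definition computes :: "nat \<Rightarrow> com \<Rightarrow> ('a labelled_graph \<Rightarrow> (nat \<Rightarrow> 'a) \<Rightarrow> int) \<Rightarrow> bool" where
  "computes d c \<alpha> \<longleftrightarrow> polytime (intermediate d) c
     (\<lambda>(G, \<rho>, s0) s. intermediate d (G, \<rho>, s0) s \<and> s ''res'' 0 = \<alpha> G \<rho>)"

definition computable :: "nat \<Rightarrow> ('a labelled_graph \<Rightarrow> (nat \<Rightarrow> 'a) \<Rightarrow> int) \<Rightarrow> bool" where
  "computable d \<alpha> \<longleftrightarrow> (\<exists>c. computes d c \<alpha>)"

definition decidable :: "nat \<Rightarrow> ('a labelled_graph \<Rightarrow> (nat \<Rightarrow> 'a) \<Rightarrow> bool) \<Rightarrow> bool" where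
  "decidable d \<phi> \<longleftrightarrow> computable d (\<lambda>G \<rho>. of_bool (\<phi> G \<rho>))"

named_theorems decidable_intros

lemma intermediate_unchanged:
  assumes "intermediate d x s" "unchanged d' {} s s'" "d \<le> d'"
  shows "intermediate d x s'"
proof -
  have frame: "unchanged d {} s s'" using assms(2,3) by (rule unchanged_mono) simp
  then show ?thesis
    using assms(1) unchanged_represents[OF frame] unchanged_trans[OF _ frame]
    by (auto simp: intermediate_def)
qed

lemma intermediate_upd:
  "intermediate d x s \<Longrightarrow> a \<in> {''res''} \<union> scratch ` {d..} \<Longrightarrow> intermediate d x (s(a := f))"
  by (rule intermediate_unchanged[where s = s and d' = d]) (auto intro: unchanged_upd)

lemma intermediate_set_index: "intermediate d x s \<Longrightarrow> d \<le> k \<Longrightarrow> intermediate d x (set_index k j s)"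
  by (rule intermediate_unchanged[where s = s and d' = d]) auto

lemma intermediate_represents: "intermediate d (G, \<rho>, s0) s \<Longrightarrow> represents d G \<rho> s"
  by (simp add: intermediate_def)

lemma intermediate_laid_out: "intermediate d (G, \<rho>, s0) s \<Longrightarrow> laid_out G s"
  using intermediate_represents represents_laid_out by blast

lemma computableE:
  assumes "computable d \<alpha>"
  obtains c where "computes d c \<alpha>"
  using assms by (auto simp: computable_def)

lemma decidableE:
  assumes "decidable d \<phi>"
  obtains c where "computes d c (\<lambda>G \<rho>. of_bool (\<phi> G \<rho>))"
  using assms by (auto simp: decidable_def computable_def)

lemma polytime_computes_Seq:
  assumes c: "computes d c \<alpha>"
    and rep: "\<And>x s. P x s \<Longrightarrow> represents d (G x) (\<rho> x) s"
    and frame: "\<And>x s s'. P x s \<Longrightarrow> unchanged d {} s s' \<Longrightarrow> P x s'"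
    and rest: "polytime (\<lambda>x s. P x s \<and> s ''res'' 0 = \<alpha> (G x) (\<rho> x)) c' Q"
  shows "polytime P (Seq c c') Q"
proof (rule polytime_Seq[OF _ rest])
  show "polytime P c (\<lambda>x s. P x s \<and> s ''res'' 0 = \<alpha> (G x) (\<rho> x))"
    using c unfolding computes_def
  proof (rule polytime_conseq, goal_cases)
    case (1 x s)
    with rep frame show ?case
      by (intro exI[of _ "(G x, \<rho> x, s)"]) (auto simp: intermediate_def)
  qed
qed

lemma decidable_cong:
  assumes "decidable d \<phi>" and "\<And>G \<rho>. valuation d G \<rho> \<Longrightarrow> \<phi> G \<rho> \<longleftrightarrow> \<psi> G \<rho>"
  shows "decidable d \<psi>"
proof -
  obtain c where c: "computes d c (\<lambda>G \<rho>. of_bool (\<phi> G \<rho>))" using assms(1) by (rule decidableE)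
  then have "computes d c (\<lambda>G \<rho>. of_bool (\<psi> G \<rho>))"
    unfolding computes_def
    by (rule polytime_post)
      (auto simp: assms(2)[OF represents_valuation[OF intermediate_represents]])
  then show ?thesis by (auto simp: decidable_def computable_def)
qed

definition definable :: "nat \<Rightarrow> ('a labelled_graph \<Rightarrow> (nat \<Rightarrow> 'a) \<Rightarrow> int) \<Rightarrow> bool" where
  "definable d \<alpha> \<longleftrightarrow> (\<exists>e. \<forall>G \<rho> s. represents d G \<rho> s \<longrightarrow> aval e s = \<alpha> G \<rho>)"

lemma definable_const [decidable_intros]: "definable d (\<lambda>_ _. z)"
  unfolding definable_def by (rule exI[of _ "Const z"]) simp

lemma definable_number [decidable_intros]: "i < d \<Longrightarrow> definable d (\<lambda>G \<rho>. int (number G (\<rho> i)))"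
  unfolding definable_def
  by (rule exI[of _ "index i"])
    (simp add: represents_at_vertex aval_index_at_vertex del: aval_index)

definition position :: "aexp \<Rightarrow> aexp \<Rightarrow> aexp" where
  "position e f = Add (Get ''row'' e) f"

lemma aval_position:
  assumes "laid_out G s" "u \<in> vertices G"
    and "aval e s = int (number G u)" "aval f s = int (number G w)"
  shows "aval (position e f) s = int (cell G u w)"
  using assms by (simp add: position_def cell_def laid_out_def number_less)

lemma definable_label:
  assumes "a \<in> matrices" "i < d" "j < d"
  shows "definable d (\<lambda>G \<rho>. label G a (\<rho> i, \<rho> j))"
  unfolding definable_def
proof (intro exI[of _ "Get a (position (index i) (index j))"] allI impI)
  fix G :: "'a labelled_graph" and \<rho> s assume rep: "represents d G \<rho> s"
  then have ij: "at_vertex G i (\<rho> i) s" "at_vertex G j (\<rho> j) s"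
    using assms by (simp_all add: represents_at_vertex)
  then have "aval (position (index i) (index j)) s = int (cell G (\<rho> i) (\<rho> j))"
    using rep
    by (intro aval_position aval_index_at_vertex) (auto dest: represents_laid_out at_vertex_in)
  with storesD[OF represents_stores[OF rep] assms(1)] ij
  show "aval (Get a (position (index i) (index j))) s = label G a (\<rho> i, \<rho> j)"
    by (simp add: at_vertex_in)
qed

lemma computable_definable:
  assumes "definable d \<alpha>"
  shows "computable d \<alpha>"
proof -
  obtain e where e: "\<And>G \<rho> s. represents d G \<rho> s \<Longrightarrow> aval e s = \<alpha> G \<rho>"
    using assms by (auto simp: definable_def)
  have "computes d (Put ''res'' (Const 0) e) \<alpha>"
    unfolding computes_def
    by (rule polytime_Put) (auto simp: e[OF intermediate_represents] intro: intermediate_upd)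
  then show ?thesis by (auto simp: computable_def)
qed

definition result_true :: bexp where
  "result_true = Less (Const 0) (Get ''res'' (Const 0))"

lemma bval_result_true: "s ''res'' 0 = of_bool b \<Longrightarrow> bval result_true s \<longleftrightarrow> b"
  by (simp add: result_true_def)

lemma computable_if:
  assumes "decidable d \<phi>" "computable d \<alpha>" "computable d \<beta>"
  shows "computable d (\<lambda>G \<rho>. if \<phi> G \<rho> then \<alpha> G \<rho> else \<beta> G \<rho>)"
proof -
  obtain b c c' where b: "computes d b (\<lambda>G \<rho>. of_bool (\<phi> G \<rho>))" and c: "computes d c \<alpha>"
    and c': "computes d c' \<beta>" using assms by (auto simp: decidable_def computable_def)
  have "computes d (Seq b (Cond result_true c c')) (\<lambda>G \<rho>. if \<phi> G \<rho> then \<alpha> G \<rho> else \<beta> G \<rho>)"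
    unfolding computes_def
  proof (rule polytime_computes_Seq[OF b, where G = fst and \<rho> = "\<lambda>(_, \<rho>, _). \<rho>"])
    show "polytime (\<lambda>x s. intermediate d x s \<and>
        s ''res'' 0 = of_bool (\<phi> (fst x) (case x of (_, \<rho>, _) \<Rightarrow> \<rho>))) (Cond result_true c c')
      (\<lambda>(G, \<rho>, s0) s. intermediate d (G, \<rho>, s0) s \<and>
        s ''res'' 0 = (if \<phi> G \<rho> then \<alpha> G \<rho> else \<beta> G \<rho>))"
      using c c' unfolding computes_def
      by (intro polytime_Cond) (erule polytime_conseq, force simp: bval_result_true)+
  qed (auto intro: intermediate_represents intermediate_unchanged)
  then show ?thesis by (auto simp: computable_def)
qed

lemma decidable_less [decidable_intros]:
  assumes "definable d \<alpha>" "definable d \<beta>"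
  shows "decidable d (\<lambda>G \<rho>. \<alpha> G \<rho> < \<beta> G \<rho>)"
proof -
  obtain e f where e: "\<And>G \<rho> s. represents d G \<rho> s \<Longrightarrow> aval e s = \<alpha> G \<rho>"
    and f: "\<And>G \<rho> s. represents d G \<rho> s \<Longrightarrow> aval f s = \<beta> G \<rho>"
    using assms by (auto simp: definable_def)
  have "computes d
      (Cond (Less e f) (Put ''res'' (Const 0) (Const 1)) (Put ''res'' (Const 0) (Const 0)))
      (\<lambda>G \<rho>. of_bool (\<alpha> G \<rho> < \<beta> G \<rho>))"
    unfolding computes_def
    by (intro polytime_Cond polytime_Put)
      (auto simp: e[OF intermediate_represents] f[OF intermediate_represents]
        intro: intermediate_upd)
  then show ?thesis by (auto simp: decidable_def computable_def)
qed

lemma decidable_if: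
  assumes "decidable d \<phi>" "decidable d \<psi>" "decidable d \<chi>"
  shows "decidable d (\<lambda>G \<rho>. if \<phi> G \<rho> then \<psi> G \<rho> else \<chi> G \<rho>)"
  using computable_if[OF assms[unfolded decidable_def[of d \<psi>] decidable_def[of d \<chi>]]]
  by (simp add: decidable_def if_distrib)

lemma decidable_const [decidable_intros]: "decidable d (\<lambda>_ _. b)"
  by (simp add: decidable_def computable_definable definable_const)

lemma decidable_not [decidable_intros]: "decidable d \<phi> \<Longrightarrow> decidable d (\<lambda>G \<rho>. \<not> \<phi> G \<rho>)"
  by (rule decidable_cong[OF decidable_if[of d \<phi> "\<lambda>_ _. False" "\<lambda>_ _. True"]])
    (auto simp: decidable_const)

lemma decidable_conj [decidable_intros]:
  "decidable d \<phi> \<Longrightarrow> decidable d \<psi> \<Longrightarrow> decidable d (\<lambda>G \<rho>. \<phi> G \<rho> \<and> \<psi> G \<rho>)"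
  by (rule decidable_cong[OF decidable_if[of d \<phi> \<psi> "\<lambda>_ _. False"]])
    (auto simp: decidable_const)

lemma decidable_disj [decidable_intros]:
  "decidable d \<phi> \<Longrightarrow> decidable d \<psi> \<Longrightarrow> decidable d (\<lambda>G \<rho>. \<phi> G \<rho> \<or> \<psi> G \<rho>)"
  by (rule decidable_cong[OF decidable_if[of d \<phi> "\<lambda>_ _. True" \<psi>]])
    (auto simp: decidable_const)

lemma decidable_imp [decidable_intros]:
  "decidable d \<phi> \<Longrightarrow> decidable d \<psi> \<Longrightarrow> decidable d (\<lambda>G \<rho>. \<phi> G \<rho> \<longrightarrow> \<psi> G \<rho>)"
  by (rule decidable_cong[OF decidable_if[of d \<phi> \<psi> "\<lambda>_ _. True"]])
    (auto simp: decidable_const)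

lemma decidable_eq_int [decidable_intros]:
  assumes "definable d \<alpha>" "definable d \<beta>"
  shows "decidable d (\<lambda>G \<rho>. \<alpha> G \<rho> = \<beta> G \<rho>)"
proof -
  have "decidable d (\<lambda>G \<rho>. \<not> \<alpha> G \<rho> < \<beta> G \<rho> \<and> \<not> \<beta> G \<rho> < \<alpha> G \<rho>)"
    by (intro decidable_conj decidable_not decidable_less assms)
  then show ?thesis by (rule decidable_cong) auto
qed

lemma decidable_eq_vertex [decidable_intros]:
  assumes "i < d" "j < d"
  shows "decidable d (\<lambda>G \<rho>. \<rho> i = \<rho> j)"
proof -
  have "decidable d (\<lambda>G \<rho>. int (number G (\<rho> i)) = int (number G (\<rho> j)))"
    by (intro decidable_eq_int definable_number assms)
  then show ?thesis by (rule decidable_cong) (use assms in \<open>simp add: valuation_def number_eq_iff\<close>)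
qed

lemma decidable_le [decidable_intros]:
  assumes "definable d \<alpha>" "definable d \<beta>"
  shows "decidable d (\<lambda>G \<rho>. \<alpha> G \<rho> \<le> \<beta> G \<rho>)"
proof -
  have "decidable d (\<lambda>G \<rho>. \<not> \<beta> G \<rho> < \<alpha> G \<rho>)" by (intro decidable_intros assms)
  then show ?thesis by (simp add: not_less)
qed

lemma decidable_Bex [decidable_intros]:
  assumes body: "decidable (Suc d) (\<lambda>G \<rho>. \<phi> G \<rho> (\<rho> d))"
    and local: "\<And>G \<rho> k w u. d \<le> k \<Longrightarrow> \<phi> G (\<rho>(k := w)) u \<longleftrightarrow> \<phi> G \<rho> u"
  shows "decidable d (\<lambda>G \<rho>. \<exists>u\<in>vertices G. \<phi> G \<rho> u)"
proof -
  obtain c where c: "computes (Suc d) c (\<lambda>G \<rho>. of_bool (\<phi> G \<rho> (\<rho> d)))"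
    using body by (rule decidableE)
  define I where "I = (\<lambda>(G, \<rho>, s0) U s. intermediate d (G, \<rho>, s0) s \<and>
    s (scratch d) 0 = of_bool (\<exists>u\<in>U. \<phi> G \<rho> u))"
  define found where "found = Put (scratch d) (Const 0) (Const 1)"
  have loop: "polytime (\<lambda>x. I x {}) (for_loop d (Seq c (Cond result_true found Skip)))
      (\<lambda>x. I x (vertices (fst x)))"
  proof (rule polytime_for_vertices[OF polytime_computes_Seq[OF c,
          where G = "fst \<circ> fst" and \<rho> = "\<lambda>((_, \<rho>, _), _, u). \<rho>(d := u)"]], goal_cases)
    case (1 y s)
    then show ?case by (auto simp: I_def intro!: represents_Suc intro: intermediate_represents)
  next
    case (2 y s s')
    then show ?case
      by (auto simp: I_def unchanged_scratchD unchanged_at_vertex intro: intermediate_unchanged)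
  next
    case 3
    show ?case unfolding found_def
      by (intro polytime_Cond_Skip polytime_Put)
        (auto simp: I_def bval_result_true local intro: intermediate_upd)
  qed (auto simp: I_def intro: intermediate_laid_out intermediate_set_index)
  have "computes d (Seq (Put (scratch d) (Const 0) (Const 0))
      (Seq (for_loop d (Seq c (Cond result_true found Skip)))
        (Put ''res'' (Const 0) (Get (scratch d) (Const 0)))))
      (\<lambda>G \<rho>. of_bool (\<exists>u\<in>vertices G. \<phi> G \<rho> u))"
    unfolding computes_def
    by (rule polytime_Seq[OF polytime_Put polytime_Seq[OF loop polytime_Put]])
      (auto simp: I_def intro: intermediate_upd)
  then show ?thesis by (auto simp: decidable_def computable_def)
qed


section \<open>Deciding reachability\<close>

definition propagated :: "'a rel \<Rightarrow> 'a set \<Rightarrow> 'a rel \<Rightarrow> 'a set \<Rightarrow> bool" where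
  "propagated R S E S' \<longleftrightarrow> S \<union> (R \<inter> E) `` S \<subseteq> S' \<and> S' \<subseteq> R\<^sup>* `` S"

lemma propagated_empty: "propagated R S {} S"
  by (auto simp: propagated_def)

lemma propagated_insert:
  assumes "propagated R S E S'"
  shows "propagated R S (insert (u, w) E) (if (u, w) \<in> R \<and> u \<in> S' then insert w S' else S')"
proof -
  have "w \<in> R\<^sup>* `` S" if "(u, w) \<in> R" "u \<in> S'"
  proof -
    have "u \<in> R\<^sup>* `` S" using assms that(2) by (auto simp: propagated_def)
    then show ?thesis using that(1) by (auto intro: rtrancl_into_rtrancl)
  qed
  then show ?thesis using assms by (auto simp: propagated_def)
qed

lemma closed_or_growing:
  assumes "propagated R S E S'" "R \<subseteq> E" "finite S'" "r < card S \<or> R `` S \<subseteq> S"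
  shows "Suc r < card S' \<or> R `` S' \<subseteq> S'"
proof -
  have S': "S \<union> R `` S \<subseteq> S'" "S' \<subseteq> R\<^sup>* `` S"
    using assms(1,2) by (simp_all add: propagated_def inf.absorb1)
  show ?thesis
  proof (cases "R `` S \<subseteq> S")
    case True
    then have "S' = S" using S' Image_closed_trancl[OF True] by auto
    with True show ?thesis by simp
  next
    case False
    then have "S \<subset> S'" using S'(1) by auto
    with assms(3) have "card S < card S'" by (rule psubset_card_mono)
    with False assms(4) show ?thesis by simp
  qed
qed

definition marked :: "nat \<Rightarrow> 'a labelled_graph \<Rightarrow> 'a set \<Rightarrow> state \<Rightarrow> bool" where
  "marked d G S s \<longleftrightarrow> S \<subseteq> vertices G \<and>
     (\<forall>u\<in>vertices G. s (scratch d) (int (number G u)) = of_bool (u \<in> S))"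

lemma marked_cong: "s' (scratch d) = s (scratch d) \<Longrightarrow> marked d G S s' \<longleftrightarrow> marked d G S s"
  by (simp add: marked_def)

lemma markedD:
  "marked d G S s \<Longrightarrow> u \<in> vertices G \<Longrightarrow> s (scratch d) (int (number G u)) = of_bool (u \<in> S)"
  by (simp add: marked_def)

lemma marked_set_index [simp]: "marked d G S (set_index k j s) \<longleftrightarrow> marked d G S s"
  by (simp add: marked_def)

lemma marked_insert:
  assumes "well_numbered G" "marked d G S s" "w \<in> vertices G"
  shows "marked d G (insert w S) (s(scratch d := (s (scratch d))(int (number G w) := 1)))"
  using assms by (auto simp: marked_def number_eq_iff)

text \<open>
  A round of propagation over all pairs of vertices marks a new vertex unless the set of marked
  vertices is closed under \<open>R\<close>, so that as many rounds as there are vertices suffice.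
\<close>

definition mark_reachable :: "nat \<Rightarrow> nat \<Rightarrow> com \<Rightarrow> com" where
  "mark_reachable d i c = (let mark = (\<lambda>k. Put (scratch d) (index k) (Const 1)) in
     Seq (for_loop d (Put (scratch d) (index d) (Const 0))) (Seq (mark i)
       (for_loop d (for_pairs (Suc d) (Seq c
         (Cond (Conj result_true (Less (Const 0) (Get (scratch d) (index (Suc d)))))
           (mark (Suc (Suc d))) Skip))))))"

definition propagating ::
  "nat \<Rightarrow> ('a labelled_graph \<Rightarrow> (nat \<Rightarrow> 'a) \<Rightarrow> 'a rel) \<Rightarrow>
    'a labelled_graph \<times> (nat \<Rightarrow> 'a) \<times> 'a set \<times> state \<Rightarrow> 'a rel \<Rightarrow> state \<Rightarrow> bool" where
  "propagating d R = (\<lambda>(G, \<rho>, S, s0) E s. represents (Suc d) G \<rho> s \<and>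
     unchanged (Suc d) {scratch d} s0 s \<and> (\<exists>S'. propagated (R G \<rho>) S E S' \<and> marked d G S' s))"

lemma propagating_unchanged:
  assumes "propagating d R x E s" "unchanged (Suc d) {} s s'"
  shows "propagating d R x E s'"
proof -
  have "marked d G S s' \<longleftrightarrow> marked d G S s" for G :: "'a labelled_graph" and S
    by (rule marked_cong, rule unchanged_scratchD[OF assms(2)]) simp_all
  moreover have "unchanged (Suc d) {scratch d} s s'"
    using assms(2) by (rule unchanged_mono) simp_all
  ultimately show ?thesis
    using assms(1) unchanged_represents[OF assms(2)]
    by (auto simp: propagating_def split: prod.splits intro: unchanged_trans)
qed

lemma propagating_mark:
  assumes I: "propagating d R (G, \<rho>, S, s0) E s" and uw: "u \<in> vertices G" "w \<in> vertices G"
    and res: "s ''res'' 0 = of_bool ((u, w) \<in> R G \<rho>)"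
  shows "propagating d R (G, \<rho>, S, s0) (insert (u, w) E)
    (if bval result_true s \<and> 0 < s (scratch d) (int (number G u))
     then s(scratch d := (s (scratch d))(int (number G w) := 1)) else s)"
proof -
  from I obtain S' where S': "propagated (R G \<rho>) S E S'" "marked d G S' s"
    and rep: "represents (Suc d) G \<rho> s" and frame: "unchanged (Suc d) {scratch d} s0 s"
    by (auto simp: propagating_def)
  have b: "bval result_true s \<and> 0 < s (scratch d) (int (number G u)) \<longleftrightarrow> (u, w) \<in> R G \<rho> \<and> u \<in> S'"
    using res markedD[OF S'(2) uw(1)] by (simp add: result_true_def)
  let ?s = "s(scratch d := (s (scratch d))(int (number G w) := 1))"
  have "well_numbered G" using represents_laid_out[OF rep] by (rule laid_out_well_numbered)
  then have "marked d G (insert w S') ?s" using S'(2) uw(2) by (rule marked_insert)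
  moreover have "unchanged (Suc d) {scratch d} s ?s" by (auto intro: unchanged_upd)
  then have "represents (Suc d) G \<rho> ?s" using rep by (rule unchanged_represents) simp
  ultimately show ?thesis
    using propagated_insert[OF S'(1), of u w] S'(2) rep frame
    by (auto simp: propagating_def b intro: unchanged_upd)
qed

lemma polytime_propagate:
  fixes R :: "'a labelled_graph \<Rightarrow> (nat \<Rightarrow> 'a) \<Rightarrow> 'a rel"
  assumes c: "computes (Suc (Suc (Suc d))) c
      (\<lambda>G \<rho>. of_bool ((\<rho> (Suc d), \<rho> (Suc (Suc d))) \<in> R G \<rho>))"
    and local: "\<And>G \<rho> k w. d < k \<Longrightarrow> R G (\<rho>(k := w)) = R G \<rho>"
  shows "polytime (\<lambda>x. propagating d R x {})
    (for_pairs (Suc d) (Seq c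
      (Cond (Conj result_true (Less (Const 0) (Get (scratch d) (index (Suc d)))))
        (Put (scratch d) (index (Suc (Suc d))) (Const 1)) Skip)))
    (\<lambda>x. propagating d R x (vertices (fst x) \<times> vertices (fst x)))"
proof (rule polytime_for_vertex_pairs[OF polytime_computes_Seq[OF c, where G = "fst \<circ> fst" and
        \<rho> = "\<lambda>((_, \<rho>, _), _, u, w). \<rho>(Suc d := u, Suc (Suc d) := w)"]], goal_cases)
  case (1 y s)
  then show ?case by (auto simp: propagating_def intro!: represents_Suc)
next
  case (2 y s s')
  then have "unchanged (Suc d) {} s s'" by (auto elim: unchanged_mono)
  with 2 show ?case by (auto simp: unchanged_at_vertex intro: propagating_unchanged)
next
  case 3
  show ?case
  proof (intro polytime_Cond_Skip polytime_Put, goal_cases)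
    case (2 y s)
    obtain G \<rho> S s0 E u w where "y = ((G, \<rho>, S, s0), E, u, w)" by (metis surj_pair)
    with 2 propagating_mark[of d R G \<rho> S s0 E s u w] show ?case
      by (auto simp: local aval_index_at_vertex at_vertex_in simp del: aval_index)
  next
    case (3 y s)
    obtain G \<rho> S s0 E u w where "y = ((G, \<rho>, S, s0), E, u, w)" by (metis surj_pair)
    with 3 propagating_mark[of d R G \<rho> S s0 E s u w] show ?case
      by (auto simp: local aval_index_at_vertex at_vertex_in simp del: aval_index)
  qed simp
next
  case (4 x E s)
  then show ?case by (auto simp: propagating_def split: prod.splits intro: represents_laid_out)
next
  case (5 x E l j s)
  then show ?case by (auto intro: propagating_unchanged)
qed

definition reaching ::
  "nat \<Rightarrow> nat \<Rightarrow> ('a labelled_graph \<Rightarrow> (nat \<Rightarrow> 'a) \<Rightarrow> 'a rel) \<Rightarrow>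
    'a labelled_graph \<times> (nat \<Rightarrow> 'a) \<times> state \<Rightarrow> nat \<Rightarrow> state \<Rightarrow> bool" where
  "reaching d i R = (\<lambda>(G, \<rho>, s0) r s. intermediate d (G, \<rho>, s0) s \<and>
     (\<exists>S. \<rho> i \<in> S \<and> S \<subseteq> (R G \<rho>)\<^sup>* `` {\<rho> i} \<and> (r < card S \<or> R G \<rho> `` S \<subseteq> S) \<and>
        marked d G S s))"

lemma reaching_init:
  assumes "intermediate d (G, \<rho>, s0) s" "i < d" "marked d G {} s"
  shows "reaching d i R (G, \<rho>, s0) 0 (s(scratch d := (s (scratch d))(int (number G (\<rho> i)) := 1)))"
proof -
  have "well_numbered G" "\<rho> i \<in> vertices G"
    using represents_valuation[OF intermediate_represents[OF assms(1)]] assms(2)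
    by (simp_all add: valuation_def)
  then have "marked d G {\<rho> i} (s(scratch d := (s (scratch d))(int (number G (\<rho> i)) := 1)))"
    using marked_insert[of G d "{}" s "\<rho> i"] assms(3) by simp
  then show ?thesis
    using assms(1) by (auto simp: reaching_def intro!: exI[of _ "{\<rho> i}"] intermediate_upd)
qed

lemma reaching_round:
  assumes step: "propagating d R (G, \<rho>(d := u), S, s) (vertices G \<times> vertices G) s'"
    and local: "R G (\<rho>(d := u)) = R G \<rho>" and R: "R G \<rho> \<subseteq> vertices G \<times> vertices G"
    and frame: "unchanged d {} s0 s"
    and S: "\<rho> i \<in> S" "S \<subseteq> (R G \<rho>)\<^sup>* `` {\<rho> i}" "r < card S \<or> R G \<rho> `` S \<subseteq> S"
  shows "reaching d i R (G, \<rho>, s0) (Suc r) s'"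
proof -
  from step local obtain S' where rep: "represents (Suc d) G (\<rho>(d := u)) s'"
    and S': "propagated (R G \<rho>) S (vertices G \<times> vertices G) S'" "marked d G S' s'"
    and frame': "unchanged (Suc d) {scratch d} s s'"
    by (auto simp: propagating_def)
  have "finite S'" using S'(2) by (auto simp: marked_def intro: finite_subset)
  then have "Suc r < card S' \<or> R G \<rho> `` S' \<subseteq> S'" using closed_or_growing[OF S'(1) R] S(3) by blast
  moreover have "S \<subseteq> S'" "S' \<subseteq> (R G \<rho>)\<^sup>* `` S" using S'(1) by (simp_all add: propagated_def)
  moreover have "(R G \<rho>)\<^sup>* `` S \<subseteq> (R G \<rho>)\<^sup>* `` {\<rho> i}" using S(2) by (auto intro: rtrancl_trans)
  ultimately have "\<rho> i \<in> S'" "S' \<subseteq> (R G \<rho>)\<^sup>* `` {\<rho> i}" "Suc r < card S' \<or> R G \<rho> `` S' \<subseteq> S'"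
    using S(1) by blast+
  moreover have "intermediate d (G, \<rho>, s0) s'"
    using represents_SucD[OF rep] unchanged_trans[OF frame unchanged_SucD[OF frame']]
    by (simp add: intermediate_def)
  ultimately show ?thesis
    using S'(2) unfolding reaching_def prod.case by (intro conjI exI[of _ S'])
qed

lemma reaching_all:
  assumes "reaching d i R (G, \<rho>, s0) (card (vertices G)) s"
  shows "marked d G ((R G \<rho>)\<^sup>* `` {\<rho> i}) s"
proof -
  from assms obtain S where S: "\<rho> i \<in> S" "S \<subseteq> (R G \<rho>)\<^sup>* `` {\<rho> i}" "marked d G S s"
    and closed: "card (vertices G) < card S \<or> R G \<rho> `` S \<subseteq> S"
    by (auto simp: reaching_def)
  have "card S \<le> card (vertices G)" using S(3) by (simp add: marked_def card_mono)
  then have "(R G \<rho>)\<^sup>* `` S = S" using closed by (simp add: Image_closed_trancl)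
  with S(1,2) have "S = (R G \<rho>)\<^sup>* `` {\<rho> i}" by blast
  with S(3) show ?thesis by simp
qed

lemma polytime_rounds:
  fixes R :: "'a labelled_graph \<Rightarrow> (nat \<Rightarrow> 'a) \<Rightarrow> 'a rel"
  assumes round: "polytime (\<lambda>x. propagating d R x {}) c
      (\<lambda>x. propagating d R x (vertices (fst x) \<times> vertices (fst x)))"
    and local: "\<And>G \<rho> k w. d \<le> k \<Longrightarrow> R G (\<rho>(k := w)) = R G \<rho>"
    and R: "\<And>G \<rho>. valuation d G \<rho> \<Longrightarrow> R G \<rho> \<subseteq> vertices G \<times> vertices G"
  shows "polytime (\<lambda>x. reaching d i R x 0) (for_loop d c)
    (\<lambda>x. reaching d i R x (card (vertices (fst x))))"
proof -
  have "polytime (\<lambda>x. reaching d i R x (card ({} :: 'a set))) (for_loop d c)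
      (\<lambda>x. reaching d i R x (card (vertices (fst x))))"
  proof (rule polytime_for_vertices[where I = "\<lambda>x U. reaching d i R x (card U)",
        OF polytime_conseq[OF round]], goal_cases)
    case (1 y s)
    obtain G \<rho> s0 U u where y: "y = ((G, \<rho>, s0), U, u)" by (metis surj_pair)
    with 1 have reach: "reaching d i R (G, \<rho>, s0) (card U) s" and u: "at_vertex G d u s"
      and U: "card (insert u U) = Suc (card U)"
      by (auto simp: finite_subset[OF _ finite_vertices])
    then obtain S where S: "\<rho> i \<in> S" "S \<subseteq> (R G \<rho>)\<^sup>* `` {\<rho> i}" "card U < card S \<or> R G \<rho> `` S \<subseteq> S"
      and marked: "marked d G S s" and rep: "represents d G \<rho> s" and frame: "unchanged d {} s0 s"
      by (auto simp: reaching_def intermediate_def)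
    have "propagating d R (G, \<rho>(d := u), S, s) {} s"
      using represents_Suc[OF rep u] marked by (auto simp: propagating_def intro: propagated_empty)
    moreover have "reaching d i R (G, \<rho>, s0) (Suc (card U)) s' \<and> at_vertex G d u s'"
      if "propagating d R (G, \<rho>(d := u), S, s) (vertices G \<times> vertices G) s'" for s'
      using reaching_round[OF that local[OF order_refl] R[OF represents_valuation[OF rep]] frame S]
        that u by (auto simp: propagating_def unchanged_at_vertex)
    ultimately show ?case
      by (intro exI[of _ "(G, \<rho>(d := u), S, s)"]) (simp add: y U)
  next
    case (3 x U j s)
    then show ?case by (simp add: reaching_def intermediate_set_index split: prod.splits)
  qed (auto simp: reaching_def intro: intermediate_laid_out)
  then show ?thesis by simp
qed

lemma polytime_mark_reachable:
  fixes R :: "'a labelled_graph \<Rightarrow> (nat \<Rightarrow> 'a) \<Rightarrow> 'a rel"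
  assumes c: "computes (Suc (Suc (Suc d))) c
      (\<lambda>G \<rho>. of_bool ((\<rho> (Suc d), \<rho> (Suc (Suc d))) \<in> R G \<rho>))"
    and local: "\<And>G \<rho> k w. d \<le> k \<Longrightarrow> R G (\<rho>(k := w)) = R G \<rho>"
    and R: "\<And>G \<rho>. valuation d G \<rho> \<Longrightarrow> R G \<rho> \<subseteq> vertices G \<times> vertices G"
    and "i < d"
  shows "polytime (intermediate d) (mark_reachable d i c)
    (\<lambda>(G, \<rho>, s0) s. intermediate d (G, \<rho>, s0) s \<and> marked d G ((R G \<rho>)\<^sup>* `` {\<rho> i}) s)"
proof -
  define C where "C = (\<lambda>(x :: 'a labelled_graph \<times> (nat \<Rightarrow> 'a) \<times> state) U s.
    intermediate d x s \<and> (\<forall>u\<in>U. s (scratch d) (int (number (fst x) u)) = 0))"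
  have clear: "polytime (\<lambda>x. C x {}) (for_loop d (Put (scratch d) (index d) (Const 0)))
      (\<lambda>x. C x (vertices (fst x)))"
    by (intro polytime_for_vertices polytime_Put)
      (auto simp: C_def aval_index_at_vertex simp del: aval_index
        intro: intermediate_upd intermediate_set_index intermediate_laid_out)
  have source: "polytime (\<lambda>x. C x (vertices (fst x))) (Put (scratch d) (index i) (Const 1))
      (\<lambda>x. reaching d i R x 0)"
  proof (rule polytime_Put)
    fix x :: "'a labelled_graph \<times> (nat \<Rightarrow> 'a) \<times> state" and s
    obtain G \<rho> s0 where x: "x = (G, \<rho>, s0)" by (rule prod_cases3)
    assume "C x (vertices (fst x)) s"
    then have init: "intermediate d (G, \<rho>, s0) s" "marked d G {} s"
      by (simp_all add: C_def x marked_def)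
    then have "aval (index i) s = int (number G (\<rho> i))"
      using \<open>i < d\<close> by (intro aval_index_at_vertex represents_at_vertex[OF intermediate_represents])
    with reaching_init[OF init(1) \<open>i < d\<close> init(2)] show "reaching d i R x 0
        (s(scratch d := (s (scratch d))(aval (index i) s := aval (Const 1) s)))"
      by (simp add: x del: aval_index)
  qed simp
  have "polytime (\<lambda>x. C x {}) (mark_reachable d i c)
      (\<lambda>x. reaching d i R x (card (vertices (fst x))))"
    unfolding mark_reachable_def Let_def
    by (intro polytime_Seq[OF clear] polytime_Seq[OF source] polytime_rounds polytime_propagate)
      (simp_all add: c local R)
  then show ?thesis
    by (rule polytime_pre[OF polytime_post])
      (auto simp: C_def intro: reaching_all, simp_all add: reaching_def)
qed

lemma decidable_rtrancl:
  assumes body: "decidable (Suc (Suc (Suc d))) (\<lambda>G \<rho>. (\<rho> (Suc d), \<rho> (Suc (Suc d))) \<in> R G \<rho>)"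
    and local: "\<And>G \<rho> k w. d \<le> k \<Longrightarrow> R G (\<rho>(k := w)) = R G \<rho>"
    and R: "\<And>G \<rho>. valuation d G \<rho> \<Longrightarrow> R G \<rho> \<subseteq> vertices G \<times> vertices G"
    and ij: "i < d" "j < d"
  shows "decidable d (\<lambda>G \<rho>. (\<rho> i, \<rho> j) \<in> (R G \<rho>)\<^sup>*)"
proof -
  obtain c where c: "computes (Suc (Suc (Suc d))) c
      (\<lambda>G \<rho>. of_bool ((\<rho> (Suc d), \<rho> (Suc (Suc d))) \<in> R G \<rho>))"
    using body by (rule decidableE)
  have "computes d (Seq (mark_reachable d i c) (Put ''res'' (Const 0) (Get (scratch d) (index j))))
      (\<lambda>G \<rho>. of_bool ((\<rho> i, \<rho> j) \<in> (R G \<rho>)\<^sup>*))"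
    unfolding computes_def
  proof (rule polytime_Seq[OF polytime_mark_reachable[OF c local R ij(1)] polytime_Put], goal_cases)
    case (4 x s)
    obtain G \<rho> s0 where x: "x = (G, \<rho>, s0)" by (rule prod_cases3)
    with 4 have "at_vertex G j (\<rho> j) s"
      using ij by (auto intro: represents_at_vertex intermediate_represents)
    with 4 show ?case
      by (auto simp: x markedD at_vertex_in aval_index_at_vertex simp del: aval_index
          intro: intermediate_upd)
  qed simp_all
  then show ?thesis by (auto simp: decidable_def computable_def)
qed


section \<open>Paths as reachability\<close>

lemma path_edges_simps [simp]:
  "path_edges [] = {}" "path_edges [u] = {}"
  "path_edges (u # w # p) = insert (u, w) (path_edges (w # p))"
  by (simp_all add: path_edges_def)

lemma path_edges_snoc: "p \<noteq> [] \<Longrightarrow> path_edges (p @ [w]) = insert (last p, w) (path_edges p)"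
proof (induction p)
  case (Cons u p)
  then show ?case by (cases p) auto
qed simp

lemma path_edges_prefix: "path_edges p \<subseteq> path_edges (p @ q)"
proof (induction p)
  case (Cons u p)
  then show ?case by (cases p) auto
qed simp

lemma finite_path_edges: "finite (path_edges p)"
  by (simp add: path_edges_def)

lemma path_imp_rtrancl:
  assumes "is_path F u p w" "\<forall>e\<in>path_edges p. Q e"
  shows "(u, w) \<in> {e \<in> dom F. Q e}\<^sup>*"
  using assms
proof (induction p arbitrary: u)
  case (Cons a p)
  show ?case
  proof (cases p)
    case Nil
    with Cons.prems show ?thesis by (auto simp: is_path_def)
  next
    case (Cons b q)
    with Cons.prems have "(u, b) \<in> {e \<in> dom F. Q e}" and "is_path F b p w"
      and "\<forall>e\<in>path_edges p. Q e"
      by (auto simp: is_path_def)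
    with Cons.IH show ?thesis by (meson converse_rtrancl_into_rtrancl)
  qed
qed (simp add: is_path_def)

lemma rtrancl_imp_path:
  assumes "(u, w) \<in> {e \<in> dom F. Q e}\<^sup>*"
  shows "\<exists>p. is_path F u p w \<and> (\<forall>e\<in>path_edges p. Q e)"
  using assms
proof (induction rule: rtrancl_induct)
  case base
  show ?case by (intro exI[of _ "[u]"]) (simp add: is_path_def)
next
  case (step x z)
  then obtain p where p: "is_path F u p x" "\<forall>e\<in>path_edges p. Q e" by blast
  show ?case
  proof (cases "z \<in> set p")
    case False
    with p step.hyps(2) show ?thesis
      by (intro exI[of _ "p @ [z]"]) (auto simp: is_path_def path_edges_snoc)
  next
    case True
    then obtain q r where "p = q @ z # r" by (meson split_list)
    with p path_edges_prefix[of "q @ [z]" r] show ?thesis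
      by (intro exI[of _ "q @ [z]"]) (auto simp: is_path_def hd_append split: if_splits)
  qed
qed

lemma ex_path_iff_rtrancl:
  "(\<exists>p. is_path F u p w \<and> (\<forall>e\<in>path_edges p. Q e)) \<longleftrightarrow> (u, w) \<in> {e \<in> dom F. Q e}\<^sup>*"
  by (intro iffI rtrancl_imp_path) (elim exE conjE path_imp_rtrancl)

lemma set_eq_path_vertices: "p \<noteq> [] \<Longrightarrow> set p = insert (hd p) (snd ` path_edges p)"
proof (induction p)
  case (Cons u p)
  then show ?case by (cases p) auto
qed simp

lemma fst_path_edges: "e \<in> path_edges p \<Longrightarrow> fst e \<in> set p"
  unfolding path_edges_def by (metis prod.collapse set_zip_leftD)

lemma ex_avoiding_path_iff_rtrancl:
  "(\<exists>p. is_path F u p w \<and> (\<forall>e\<in>path_edges p. Q e) \<and> y \<notin> set p) \<longleftrightarrow>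
    u \<noteq> y \<and> (u, w) \<in> {e \<in> dom F. Q e \<and> fst e \<noteq> y \<and> snd e \<noteq> y}\<^sup>*"
proof -
  have "y \<notin> set p \<longleftrightarrow> u \<noteq> y \<and> (\<forall>e\<in>path_edges p. fst e \<noteq> y \<and> snd e \<noteq> y)"
    if "is_path F u p w" for p
    using that set_eq_path_vertices[of p] fst_path_edges[of _ p]
    by (auto simp: is_path_def)
  then have "(\<exists>p. is_path F u p w \<and> (\<forall>e\<in>path_edges p. Q e) \<and> y \<notin> set p) \<longleftrightarrow>
    u \<noteq> y \<and> (\<exists>p. is_path F u p w \<and> (\<forall>e\<in>path_edges p. Q e \<and> fst e \<noteq> y \<and> snd e \<noteq> y))"
    by blast
  then show ?thesis by (simp only: ex_path_iff_rtrancl)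
qed

lemma strength_greater_iff:
  "strength m p > ereal (real_of_int k) \<longleftrightarrow> (\<forall>e\<in>path_edges p. m e > k)"
  unfolding strength_def using finite_path_edges[of p] by (subst Min_gr_iff) auto

lemma strength_ge_iff:
  "strength m p \<ge> ereal (real_of_int k) \<longleftrightarrow> (\<forall>e\<in>path_edges p. m e \<ge> k)"
  unfolding strength_def using finite_path_edges[of p] by (subst Min_ge_iff) auto

definition strong_edges :: "('a \<times> 'a \<Rightarrow> int) \<Rightarrow> 'a diagram \<Rightarrow> int \<Rightarrow> ('a \<times> 'a) set" where
  "strong_edges m F k = {e \<in> dom F. m e > k}"

definition forbidden_edge :: "('a \<times> 'a \<Rightarrow> int) \<Rightarrow> 'a diagram \<Rightarrow> 'a \<Rightarrow> 'a \<times> 'a \<Rightarrow> bool" where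
  "forbidden_edge m F y = (\<lambda>(c, d). F (c, d) = Some CC \<and> d \<noteq> y \<and>
     (d, c) \<in> {e \<in> dom F. m e \<ge> m (c, d) \<and> fst e \<noteq> y \<and> snd e \<noteq> y}\<^sup>*)"

lemma reject_cycle_iff:
  "reject_cycle A m F x y \<longleftrightarrow>
     (y, x) \<in> (strong_edges m F (m (x, y)))\<^sup>* \<and>
     (\<forall>u\<in>A. (u, x) \<in> (strong_edges m F (m (x, y)))\<^sup>* \<longrightarrow>
        (y, u) \<in> {e \<in> dom F. m e > m (x, y) \<and> \<not> forbidden_edge m F y e}\<^sup>*)"
proof -
  have bad: "(F (c, d) = Some CC \<longrightarrow>
       (\<forall>q. is_path F d q c \<and> strength m q \<ge> ereal (real_of_int (m (c, d))) \<longrightarrow> y \<in> set q)) \<longleftrightarrow>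
     \<not> forbidden_edge m F y (c, d)" for c d
    using ex_avoiding_path_iff_rtrancl[of F d c "\<lambda>e. m e \<ge> m (c, d)" y]
    by (auto simp: forbidden_edge_def strength_ge_iff)
  have "(\<exists>p. is_path F y p u \<and> strength m p > ereal (real_of_int (m (x, y))) \<and>
      (\<forall>(c, d) \<in> path_edges p. \<not> forbidden_edge m F y (c, d))) \<longleftrightarrow>
    (\<exists>p. is_path F y p u \<and> (\<forall>e\<in>path_edges p. m e > m (x, y) \<and> \<not> forbidden_edge m F y e))" for u
    by (auto simp: strength_greater_iff)
  then show ?thesis
    unfolding reject_cycle_def Let_def bad strength_greater_iff ex_path_iff_rtrancl strong_edges_def
    by auto
qed


section \<open>Deciding the steps of the FUN algorithm\<close>

lemma decidable_Ball [decidable_intros]: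
  assumes "decidable (Suc d) (\<lambda>G \<rho>. \<phi> G \<rho> (\<rho> d))"
    and "\<And>G \<rho> k w u. d \<le> k \<Longrightarrow> \<phi> G (\<rho>(k := w)) u \<longleftrightarrow> \<phi> G \<rho> u"
  shows "decidable d (\<lambda>G \<rho>. \<forall>u\<in>vertices G. \<phi> G \<rho> u)"
proof -
  have "decidable d (\<lambda>G \<rho>. \<not> (\<exists>u\<in>vertices G. \<not> \<phi> G \<rho> u))"
    using assms by (intro decidable_not decidable_Bex) auto
  then show ?thesis by simp
qed

lemma decidable_Collect [decidable_intros]:
  "decidable d (\<lambda>G \<rho>. \<phi> G \<rho> (e G \<rho>)) \<Longrightarrow> decidable d (\<lambda>G \<rho>. e G \<rho> \<in> Collect (\<phi> G \<rho>))"
  by simp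

lemma decidable_dom [decidable_intros]:
  "decidable d (\<lambda>G \<rho>. \<not> F G \<rho> (e G \<rho>) = None) \<Longrightarrow> decidable d (\<lambda>G \<rho>. e G \<rho> \<in> dom (F G \<rho>))"
  by (simp add: domIff)

lemma decidable_eq_edge [decidable_intros]:
  assumes "i < d" "j < d" "k < d" "l < d"
  shows "decidable d (\<lambda>G \<rho>. (\<rho> i, \<rho> j) = (\<rho> k, \<rho> l))"
  unfolding prod.inject by (intro decidable_conj decidable_eq_vertex assms)

lemma decidable_if_eq [decidable_intros]:
  assumes "decidable d \<phi>" "decidable d (\<lambda>G \<rho>. \<alpha> G \<rho> = z)" "decidable d (\<lambda>G \<rho>. \<beta> G \<rho> = z)"
  shows "decidable d (\<lambda>G \<rho>. (if \<phi> G \<rho> then \<alpha> G \<rho> else \<beta> G \<rho>) = z)"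
  by (rule decidable_cong[OF decidable_if[OF assms]]) simp

abbreviation weight :: "'a labelled_graph \<Rightarrow> 'a \<times> 'a \<Rightarrow> int" where
  "weight G \<equiv> label G ''W''"

definition state_of :: "int \<Rightarrow> estate option" where
  "state_of z = (if z = 1 then Some Fix else if z = 2 then Some BC else if z = 3 then Some CC
     else if z = 4 then Some CBC else None)"

lemma state_of_simps [simp]: "state_of (state_code st) = st" "state_of (-1) = None"
  by (cases st rule: state_code.cases) (simp_all add: state_of_def)

definition diagram :: "'a labelled_graph \<Rightarrow> 'a diagram" where
  "diagram G e = (if e \<in> vertices G \<times> vertices G then state_of (label G ''S'' e) else None)"

lemma dom_diagram: "dom (diagram G) \<subseteq> vertices G \<times> vertices G"
  by (auto simp: diagram_def split: if_splits)

lemma definable_weight [decidable_intros]: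
  "i < d \<Longrightarrow> j < d \<Longrightarrow> definable d (\<lambda>G \<rho>. weight G (\<rho> i, \<rho> j))"
  by (rule definable_label) (simp_all add: matrices_def)

lemma decidable_diagram [decidable_intros]:
  assumes "i < d" "j < d"
  shows "decidable d (\<lambda>G \<rho>. diagram G (\<rho> i, \<rho> j) = st)"
proof -
  have "definable d (\<lambda>G \<rho>. label G ''S'' (\<rho> i, \<rho> j))"
    using assms by (intro definable_label) (simp_all add: matrices_def)
  then have "decidable d (\<lambda>G \<rho>. state_of (label G ''S'' (\<rho> i, \<rho> j)) = st)"
    unfolding state_of_def by (intro decidable_intros)
  then show ?thesis
    by (rule decidable_cong) (use assms in \<open>simp add: diagram_def valuation_def\<close>)
qed

lemma Bex_incoming_iff:
  assumes "dom F \<subseteq> A \<times> A"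
  shows "(\<exists>e\<in>incoming F y. Q e) \<longleftrightarrow> (\<exists>u\<in>A. F (u, y) \<noteq> None \<and> Q (u, y))"
  using assms by (force simp: incoming_def)

lemma decidable_Bex_incoming [decidable_intros]:
  assumes "decidable (Suc d) (\<lambda>G \<rho>. Q G \<rho> (\<rho> d, \<rho> y))" "y < d"
    and "\<And>G \<rho> k w e. d \<le> k \<Longrightarrow> Q G (\<rho>(k := w)) e \<longleftrightarrow> Q G \<rho> e"
  shows "decidable d (\<lambda>G \<rho>. \<exists>e\<in>incoming (diagram G) (\<rho> y). Q G \<rho> e)"
  unfolding Bex_incoming_iff[OF dom_diagram] using assms by (intro decidable_intros) auto

lemma decidable_Ball_incoming [decidable_intros]:
  assumes "decidable (Suc d) (\<lambda>G \<rho>. Q G \<rho> (\<rho> d, \<rho> y))" "y < d"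
    and "\<And>G \<rho> k w e. d \<le> k \<Longrightarrow> Q G (\<rho>(k := w)) e \<longleftrightarrow> Q G \<rho> e"
  shows "decidable d (\<lambda>G \<rho>. \<forall>e\<in>incoming (diagram G) (\<rho> y). Q G \<rho> e)"
proof -
  have "decidable d (\<lambda>G \<rho>. \<not> (\<exists>e\<in>incoming (diagram G) (\<rho> y). \<not> Q G \<rho> e))"
    using assms by (intro decidable_not decidable_Bex_incoming) auto
  then show ?thesis by simp
qed

lemma decidable_not_dominated [decidable_intros]:
  assumes "y < d"
  shows "decidable d (\<lambda>G \<rho>. not_dominated (diagram G) (\<rho> y))"
proof -
  have "not_dominated F y \<longleftrightarrow> \<not> (\<exists>e\<in>incoming F y. True)" for F and y :: 'a
    by (auto simp: not_dominated_def)
  then show ?thesis using assms by (simp only:) (intro decidable_intros; simp)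
qed

lemma decidable_cycle_dominated [decidable_intros]:
  assumes "y < d"
  shows "decidable d (\<lambda>G \<rho>. cycle_dominated (diagram G) (\<rho> y))"
proof -
  have "cycle_dominated F y \<longleftrightarrow> \<not> not_dominated F y \<and> (\<forall>e\<in>incoming F y. F e = Some CC)"
    for F and y :: 'a
    by (simp add: cycle_dominated_def not_dominated_def)
  then show ?thesis using assms by (simp only:) (intro decidable_intros; simp)
qed

lemma decidable_fixedly_dominated [decidable_intros]:
  assumes "y < d"
  shows "decidable d (\<lambda>G \<rho>. fixedly_dominated (diagram G) (\<rho> y))"
proof -
  have "fixedly_dominated F y \<longleftrightarrow>
      (\<exists>e\<in>incoming F y. F e = Some Fix \<and> (\<forall>e'\<in>incoming F y. e' = e)) \<or>
      (\<exists>e\<in>incoming F y. F e = Some BC \<or> F e = Some CBC)" for F and y :: 'a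
    unfolding fixedly_dominated_def by blast
  then show ?thesis using assms by (simp only:) (intro decidable_intros; simp)
qed

lemma decidable_reject_dominated [decidable_intros]:
  assumes "x < d" "y < d"
  shows "decidable d (\<lambda>G \<rho>. reject_dominated (weight G) (diagram G) (\<rho> x) (\<rho> y))"
  unfolding reject_dominated_def using assms by (intro decidable_intros; simp)

lemma decidable_rtrancl_dom [decidable_intros]:
  assumes "decidable (Suc (Suc (Suc d))) (\<lambda>G \<rho>. \<phi> G \<rho> (\<rho> (Suc d), \<rho> (Suc (Suc d))))"
    and "\<And>G \<rho> k w e. d \<le> k \<Longrightarrow> \<phi> G (\<rho>(k := w)) e \<longleftrightarrow> \<phi> G \<rho> e" and "i < d" "j < d"
  shows "decidable d (\<lambda>G \<rho>. (\<rho> i, \<rho> j) \<in> {e \<in> dom (diagram G). \<phi> G \<rho> e}\<^sup>*)"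
proof (rule decidable_rtrancl)
  show "decidable (Suc (Suc (Suc d))) (\<lambda>G \<rho>.
      (\<rho> (Suc d), \<rho> (Suc (Suc d))) \<in> {e \<in> dom (diagram G). \<phi> G \<rho> e})"
    using assms(1) by (intro decidable_intros) simp_all
  show "{e \<in> dom (diagram G). \<phi> G \<rho> e} \<subseteq> vertices G \<times> vertices G" for G :: "'a labelled_graph" and \<rho>
    using dom_diagram[of G] by blast
qed (use assms in simp_all)

lemma decidable_forbidden_edge [decidable_intros]:
  assumes "y < d" "i < d" "j < d"
  shows "decidable d (\<lambda>G \<rho>. forbidden_edge (weight G) (diagram G) (\<rho> y) (\<rho> i, \<rho> j))"
  unfolding forbidden_edge_def prod.case using assms
  by (intro decidable_intros; simp add: decidable_eq_vertex)

lemma decidable_reject_cycle [decidable_intros]: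
  assumes "x < d" "y < d"
  shows "decidable d (\<lambda>G \<rho>. reject_cycle (vertices G) (weight G) (diagram G) (\<rho> x) (\<rho> y))"
  unfolding reject_cycle_iff strong_edges_def using assms by (intro decidable_intros; simp)

lemma add_edge_apply:
  "add_edge m F x y e =
    (if e = (x, y) then
       if not_dominated F y then Some Fix
       else if cycle_dominated F y \<and> (\<exists>f\<in>incoming F y. m (x, y) < m f) then Some CBC
       else Some BC
     else if snd e = y \<and> F e = Some Fix then Some BC else F e)"
proof -
  have fix_iff: "f \<in> incoming F y \<and> F f = Some Fix \<longleftrightarrow> snd f = y \<and> F f = Some Fix" for f
    by (auto simp: incoming_def)
  have "\<not> (snd e = y \<and> F e = Some Fix)" if "not_dominated F y \<or> cycle_dominated F y"
    using that by (auto simp: not_dominated_def cycle_dominated_def fix_iff[symmetric])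
  then show ?thesis
    by (cases "not_dominated F y"; cases "cycle_dominated F y"; cases "e = (x, y)")
      (auto simp: add_edge_def Let_def fix_iff)
qed

lemma dom_add_edge: "dom (add_edge m F x y) = insert (x, y) (dom F)"
proof -
  have "add_edge m F x y e \<noteq> None \<longleftrightarrow> e = (x, y) \<or> F e \<noteq> None" for e
    by (simp add: add_edge_apply)
  then show ?thesis by auto
qed

lemma decidable_add_edge [decidable_intros]:
  assumes "x < d" "y < d" "i < d" "j < d"
  shows "decidable d (\<lambda>G \<rho>. add_edge (weight G) (diagram G) (\<rho> x) (\<rho> y) (\<rho> i, \<rho> j) = st)"
  unfolding add_edge_apply snd_conv using assms by (intro decidable_intros; simp)

lemma mark_cycles_apply:
  "mark_cycles m F x y e =
    (if cycle_edges F x y \<noteq> {} \<and> (e = (x, y) \<or> e \<in> cycle_edges F x y \<and> m e = m (x, y))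
     then Some CC else F e)"
  by (simp add: mark_cycles_def)

lemma dom_mark_cycles: "(x, y) \<in> dom F \<Longrightarrow> dom (mark_cycles m F x y) = dom F"
  by (auto simp: mark_cycles_apply cycle_edges_def split: if_splits)

lemma dom_fun_step: "dom (fun_step A m e F) \<subseteq> insert e (dom F)"
  by (cases e) (simp add: fun_step_def dom_mark_cycles dom_add_edge subset_insertI)

lemma decidable_cycle_edges [decidable_intros]:
  assumes "x < d" "y < d" "i < d" "j < d"
  shows "decidable d (\<lambda>G \<rho>. (\<rho> i, \<rho> j) \<in>
    cycle_edges (add_edge (weight G) (diagram G) (\<rho> x) (\<rho> y)) (\<rho> x) (\<rho> y))"
proof -
  have "decidable d (\<lambda>G \<rho>. (\<rho> k, \<rho> l) \<in> (dom (add_edge (weight G) (diagram G) (\<rho> x) (\<rho> y)))\<^sup>*)"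
    if "k < d" "l < d" for k l
  proof (rule decidable_rtrancl[where
        R = "\<lambda>G \<rho>. dom (add_edge (weight G) (diagram G) (\<rho> x) (\<rho> y))"])
    show "decidable (Suc (Suc (Suc d))) (\<lambda>G \<rho>. (\<rho> (Suc d), \<rho> (Suc (Suc d))) \<in>
        dom (add_edge (weight G) (diagram G) (\<rho> x) (\<rho> y)))"
      using assms by (intro decidable_intros; simp)
    show "dom (add_edge (weight G) (diagram G) (\<rho> x) (\<rho> y)) \<subseteq> vertices G \<times> vertices G"
      if "valuation d G \<rho>" for G \<rho>
      using that assms dom_diagram[of G] by (simp add: dom_add_edge valuation_def)
  qed (use that assms in simp_all)
  then show ?thesis
    unfolding cycle_edges_def mem_Collect_eq prod.case using assms by (intro decidable_intros; simp)
qed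

lemma decidable_no_cycle_edges [decidable_intros]:
  assumes "x < d" "y < d"
  shows "decidable d (\<lambda>G \<rho>.
    cycle_edges (add_edge (weight G) (diagram G) (\<rho> x) (\<rho> y)) (\<rho> x) (\<rho> y) = {})"
    (is "decidable d (\<lambda>G \<rho>. ?C G \<rho> = {})")
proof -
  have "decidable d (\<lambda>G \<rho>. \<not> (\<exists>u\<in>vertices G. \<exists>w\<in>vertices G. (u, w) \<in> ?C G \<rho>))"
    using assms by (intro decidable_intros; simp)
  then show ?thesis
  proof (rule decidable_cong)
    fix G :: "'a labelled_graph" and \<rho> assume "valuation d G \<rho>"
    then have "?C G \<rho> \<subseteq> vertices G \<times> vertices G"
      using assms dom_diagram[of G] by (auto simp: cycle_edges_def dom_add_edge valuation_def)
    then show "\<not> (\<exists>u\<in>vertices G. \<exists>w\<in>vertices G. (u, w) \<in> ?C G \<rho>) \<longleftrightarrow> ?C G \<rho> = {}" by auto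
  qed
qed

lemma decidable_mark_cycles [decidable_intros]:
  assumes "x < d" "y < d" "i < d" "j < d"
  shows "decidable d (\<lambda>G \<rho>. mark_cycles (weight G)
    (add_edge (weight G) (diagram G) (\<rho> x) (\<rho> y)) (\<rho> x) (\<rho> y) (\<rho> i, \<rho> j) = st)"
  unfolding mark_cycles_apply using assms by (intro decidable_intros; simp)

lemma fun_step_apply:
  "fun_step A m (x, y) F e =
    (if reject_dominated m F x y \<or> reject_cycle A m F x y then F e
     else mark_cycles m (add_edge m F x y) x y e)"
  by (simp add: fun_step_def)

lemma decidable_fun_step [decidable_intros]:
  assumes "x < d" "y < d" "i < d" "j < d"
  shows "decidable d
    (\<lambda>G \<rho>. fun_step (vertices G) (weight G) (\<rho> x, \<rho> y) (diagram G) (\<rho> i, \<rho> j) = st)"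
  unfolding fun_step_apply using assms by (intro decidable_intros; simp)


section \<open>One iteration of the algorithm\<close>

text \<open>
  In the matrix \<open>''S''\<close>, the code \<open>-1\<close> marks the edges that are still to be processed. Ties are
  broken by vertex numbers after ranks, so that the next edge is unique.
\<close>

definition pending :: "'a labelled_graph \<Rightarrow> ('a \<times> 'a) set" where
  "pending G = {e \<in> vertices G \<times> vertices G. label G ''S'' e = -1}"

definition edge_key :: "'a labelled_graph \<Rightarrow> 'a \<times> 'a \<Rightarrow> int \<times> int \<times> int \<times> int" where
  "edge_key G e = (- weight G e, label G ''R'' e, int (number G (fst e)), int (number G (snd e)))"

definition next_edge :: "'a labelled_graph \<Rightarrow> 'a \<times> 'a \<Rightarrow> bool" where
  "next_edge G e \<longleftrightarrow> e \<in> pending G \<and> (\<forall>f\<in>pending G. edge_key G e \<le> edge_key G f)"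

definition next_diagram :: "'a labelled_graph \<Rightarrow> 'a diagram" where
  "next_diagram G =
     (if \<exists>e. next_edge G e then fun_step (vertices G) (weight G) (THE e. next_edge G e) (diagram G)
      else diagram G)"

definition next_status :: "'a labelled_graph \<Rightarrow> 'a \<times> 'a \<Rightarrow> int" where
  "next_status G e =
     (if e \<in> pending G \<and> \<not> next_edge G e then -1 else state_code (next_diagram G e))"

definition process_next :: "'a labelled_graph \<Rightarrow> 'a labelled_graph" where
  "process_next G = G\<lparr>label := (label G)(''S'' := next_status G)\<rparr>"

lemma edge_key_inj:
  assumes "well_numbered G"
  shows "inj_on (edge_key G) (vertices G \<times> vertices G)"
  by (auto simp: inj_on_def edge_key_def number_eq_iff[OF assms])

lemma next_edge_unique:
  assumes "well_numbered G" "next_edge G e" "next_edge G f"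
  shows "e = f"
proof (rule inj_onD[OF edge_key_inj[OF assms(1)]])
  show "edge_key G e = edge_key G f" using assms(2,3) by (auto simp: next_edge_def intro: antisym)
qed (use assms(2,3) in \<open>auto simp: next_edge_def pending_def\<close>)

lemma next_diagram_eq:
  assumes "well_numbered G" "next_edge G e"
  shows "next_diagram G = fun_step (vertices G) (weight G) e (diagram G)"
proof -
  have "(THE e. next_edge G e) = e" using assms next_edge_unique by (intro the_equality)
  moreover have "\<exists>e. next_edge G e" using assms(2) by (rule exI)
  ultimately show ?thesis by (simp only: next_diagram_def if_True)
qed

lemma decidable_pending [decidable_intros]:
  assumes "i < d" "j < d"
  shows "decidable d (\<lambda>G \<rho>. (\<rho> i, \<rho> j) \<in> pending G)"
proof -
  have "decidable d (\<lambda>G \<rho>. label G ''S'' (\<rho> i, \<rho> j) = -1)"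
    using assms by (intro decidable_intros definable_label) (simp_all add: matrices_def)
  then show ?thesis
    by (rule decidable_cong) (use assms in \<open>simp add: pending_def valuation_def\<close>)
qed

lemma decidable_next_edge [decidable_intros]:
  assumes "i < d" "j < d"
  shows "decidable d (\<lambda>G \<rho>. next_edge G (\<rho> i, \<rho> j))"
proof -
  have "decidable d (\<lambda>G \<rho>. (\<rho> i, \<rho> j) \<in> pending G \<and> (\<forall>u\<in>vertices G. \<forall>w\<in>vertices G.
      (u, w) \<in> pending G \<longrightarrow> edge_key G (\<rho> i, \<rho> j) \<le> edge_key G (u, w)))"
    unfolding edge_key_def less_eq_prod_simp fst_conv snd_conv neg_le_iff_le neg_less_iff_less
    using assms by (intro decidable_intros definable_label; simp add: matrices_def)
  then show ?thesis by (rule decidable_cong) (auto simp: next_edge_def pending_def)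
qed

lemma decidable_next_diagram [decidable_intros]:
  assumes "i < d" "j < d"
  shows "decidable d (\<lambda>G \<rho>. next_diagram G (\<rho> i, \<rho> j) = st)"
proof -
  have "decidable d (\<lambda>G \<rho>.
      (\<exists>u\<in>vertices G. \<exists>w\<in>vertices G. next_edge G (u, w) \<and>
        fun_step (vertices G) (weight G) (u, w) (diagram G) (\<rho> i, \<rho> j) = st) \<or>
      \<not> (\<exists>u\<in>vertices G. \<exists>w\<in>vertices G. next_edge G (u, w)) \<and> diagram G (\<rho> i, \<rho> j) = st)"
    using assms by (intro decidable_intros; simp)
  then show ?thesis
  proof (rule decidable_cong)
    fix G \<rho> assume "valuation d G \<rho>"
    then have G: "well_numbered G" by (simp add: valuation_def)
    let ?st = "\<lambda>F. F (\<rho> i, \<rho> j) = st"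
    let ?next = "\<exists>u\<in>vertices G. \<exists>w\<in>vertices G. next_edge G (u, w)"
    show "(\<exists>u\<in>vertices G. \<exists>w\<in>vertices G. next_edge G (u, w) \<and>
          ?st (fun_step (vertices G) (weight G) (u, w) (diagram G))) \<or>
        \<not> ?next \<and> ?st (diagram G) \<longleftrightarrow> ?st (next_diagram G)"
    proof (cases "\<exists>e. next_edge G e")
      case True
      then obtain u w where e: "next_edge G (u, w)" by auto
      then have "u \<in> vertices G" "w \<in> vertices G" by (auto simp: next_edge_def pending_def)
      moreover have "next_edge G (u', w') \<longleftrightarrow> u' = u \<and> w' = w" for u' w'
        using next_edge_unique[OF G e] e by blast
      ultimately show ?thesis by (simp add: next_diagram_eq[OF G e])
    next
      case False
      then show ?thesis by (simp add: next_diagram_def)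
    qed
  qed
qed

lemma computable_state_code:
  assumes "\<And>st. decidable d (\<lambda>G \<rho>. F G \<rho> = st)"
  shows "computable d (\<lambda>G \<rho>. state_code (F G \<rho>))"
proof -
  have "state_code st = (if st = Some Fix then 1 else if st = Some BC then 2
      else if st = Some CC then 3 else if st = Some CBC then 4 else 0)" for st
    by (cases st rule: state_code.cases) simp_all
  then show ?thesis by (simp only:) (intro computable_if computable_definable definable_const assms)
qed

lemma computable_next_status:
  assumes "i < d" "j < d"
  shows "computable d (\<lambda>G \<rho>. next_status G (\<rho> i, \<rho> j))"
  unfolding next_status_def using assms
  by (intro computable_if computable_definable definable_const computable_state_code
      decidable_intros)

lemma process_next_simps [simp]:
  "num_vertices (process_next G) = num_vertices G" "vertex (process_next G) = vertex G"
  "vertices (process_next G) = vertices G" "number (process_next G) = number G"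
  "well_numbered (process_next G) = well_numbered G"
  "label (process_next G) = (label G)(''S'' := next_status G)"
  "edge_key (process_next G) = edge_key G"
  by (simp_all add: process_next_def vertices_def number_def well_numbered_def edge_key_def
      fun_eq_iff)

lemma state_code_neq [simp]: "state_code st \<noteq> -1"
  by (cases st rule: state_code.cases) simp_all

lemma pending_process_next: "pending (process_next G) = {e \<in> pending G. \<not> next_edge G e}"
  by (auto simp: pending_def next_status_def)

lemma dom_next_diagram:
  assumes "well_numbered G"
  shows "dom (next_diagram G) \<subseteq> vertices G \<times> vertices G"
proof (cases "\<exists>e. next_edge G e")
  case True
  then obtain e where e: "next_edge G e" by blast
  then have "e \<in> vertices G \<times> vertices G" by (simp add: next_edge_def pending_def)
  with dom_fun_step dom_diagram show ?thesis
    unfolding next_diagram_eq[OF assms e] by fastforce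
next
  case False
  then show ?thesis using dom_diagram[of G] by (simp add: next_diagram_def)
qed

lemma diagram_process_next:
  assumes "well_numbered G"
  shows "diagram (process_next G) =
    (\<lambda>e. if e \<in> pending G \<and> \<not> next_edge G e then None else next_diagram G e)"
proof
  fix e
  show "diagram (process_next G) e =
      (if e \<in> pending G \<and> \<not> next_edge G e then None else next_diagram G e)"
  proof (cases "e \<in> vertices G \<times> vertices G")
    case False
    then have "next_diagram G e = None" using dom_next_diagram[OF assms] by (metis domIff subsetD)
    with False show ?thesis by (simp add: diagram_def)
  qed (simp add: diagram_def next_status_def)
qed

lemma diagram_pending: "e \<in> pending G \<Longrightarrow> diagram G e = None"
  by (simp add: pending_def diagram_def)

lemma process_next_edge:
  assumes "well_numbered G" "next_edge G e"
  shows "pending (process_next G) = pending G - {e}"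
    and "diagram (process_next G) = fun_step (vertices G) (weight G) e (diagram G)"
proof -
  have next_iff: "next_edge G f \<longleftrightarrow> f = e" for f
    using next_edge_unique[OF assms(1)] assms(2) by blast
  show "pending (process_next G) = pending G - {e}"
    by (auto simp: pending_process_next next_iff)
  have "next_diagram G f = None" if "f \<in> pending G" "f \<noteq> e" for f
  proof -
    have "f \<notin> insert e (dom (diagram G))" using that by (simp add: diagram_pending domIff)
    then show ?thesis
      unfolding next_diagram_eq[OF assms] using dom_fun_step by (metis domIff subsetD)
  qed
  then show "diagram (process_next G) = fun_step (vertices G) (weight G) e (diagram G)"
    by (simp add: diagram_process_next[OF assms(1)] next_iff fun_eq_iff
        flip: next_diagram_eq[OF assms])
qed

lemma process_next_idle:
  assumes "well_numbered G" "pending G = {}"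
  shows "pending (process_next G) = {}" and "diagram (process_next G) = diagram G"
  using assms
  by (simp_all add: pending_process_next diagram_process_next next_diagram_def next_edge_def)

lemma process_all:
  assumes "well_numbered G" "distinct es" "set es = pending G" "sorted (map (edge_key G) es)"
    and "length es \<le> k"
  shows "pending ((process_next ^^ k) G) = {} \<and>
    diagram ((process_next ^^ k) G) = fold (fun_step (vertices G) (weight G)) es (diagram G)"
  using assms
proof (induction k arbitrary: G es)
  case 0
  then show ?case by simp
next
  case (Suc k)
  show ?case
  proof (cases es)
    case Nil
    with Suc.prems have "pending G = {}" by simp
    note idle = process_next_idle[OF Suc.prems(1) this]
    from Suc.IH[of "process_next G" "[]"] Suc.prems(1) idle Nil show ?thesis
      by (simp add: funpow_Suc_right del: funpow.simps)
  next
    case (Cons e es')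
    with Suc.prems(3,4) have e: "next_edge G e" by (auto simp: next_edge_def)
    note step = process_next_edge[OF Suc.prems(1) e]
    have "set es' = pending G - {e}" using Suc.prems(2,3) Cons by auto
    with Suc.IH[of "process_next G" es'] Suc.prems step Cons show ?thesis
      by (simp add: funpow_Suc_right del: funpow.simps)
  qed
qed

lemma funpow_process_next_simps [simp]:
  "num_vertices ((process_next ^^ k) G) = num_vertices G"
  "vertex ((process_next ^^ k) G) = vertex G"
  "vertices ((process_next ^^ k) G) = vertices G"
  "well_numbered ((process_next ^^ k) G) = well_numbered G"
  by (induction k) simp_all

definition consistent :: "'a labelled_graph \<Rightarrow> bool" where
  "consistent G \<longleftrightarrow>
     (\<forall>e\<in>vertices G \<times> vertices G - pending G. label G ''S'' e = state_code (diagram G e))"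

lemma consistent_process_next: "consistent G \<Longrightarrow> consistent (process_next G)"
  by (auto simp: consistent_def pending_process_next diagram_def next_status_def)

lemma consistent_funpow: "consistent G \<Longrightarrow> consistent ((process_next ^^ k) G)"
  by (induction k) (simp_all add: consistent_process_next)

lemma ex_sorted_enumeration:
  assumes "finite S"
  shows "\<exists>es. distinct es \<and> set es = S \<and> sorted (map (f :: _ \<Rightarrow> _ :: linorder) es)"
proof -
  obtain xs where "distinct xs" "set xs = S" using finite_distinct_list[OF assms] by blast
  then have "distinct (sort_key f xs) \<and> set (sort_key f xs) = S \<and> sorted (map f (sort_key f xs))"
    by simp
  then show ?thesis by blast
qed

lemma processing_order_edge_key:
  assumes "distinct es" "set es = E" "sorted (map (edge_key G) es)"
    and "\<And>e. e \<in> E \<Longrightarrow> weight G e = m e \<and> label G ''R'' e = rank e"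
  shows "processing_order m E rank es"
proof -
  have "sorted_wrt (\<lambda>e f. edge_key G e \<le> edge_key G f) es" using assms(3) by (simp add: sorted_map)
  then have "sorted_wrt (\<lambda>e f. m e > m f \<or> m e = m f \<and> rank e \<le> rank f) es"
    by (rule sorted_wrt_mono_rel[rotated])
      (use assms(2,4) in \<open>auto simp: edge_key_def less_eq_prod_simp\<close>)
  with assms(1,2) show ?thesis by (simp add: processing_order_def)
qed


section \<open>Dependence of the algorithm on the weights\<close>

lemma fun_step_cong:
  assumes m: "\<And>f. f \<in> insert e (dom F) \<Longrightarrow> m f = m' f"
  shows "fun_step A m e F = fun_step A m' e F"
proof -
  obtain x y where e: "e = (x, y)" by (cases e)
  have inc: "m f = m' f" if "f \<in> incoming F z" for f z using that m by (simp add: incoming_def)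
  have xy: "m (x, y) = m' (x, y)" and mF: "f \<in> dom F \<Longrightarrow> m f = m' f" for f using m e by auto
  have dominated: "reject_dominated m F x y \<longleftrightarrow> reject_dominated m' F x y"
    by (simp add: reject_dominated_def xy inc)
  have strong: "{f \<in> dom F. m f > m (x, y) \<and> Q f} = {f \<in> dom F. m' f > m' (x, y) \<and> Q f}" for Q
    by (rule Collect_cong) (simp add: mF xy cong: conj_cong)
  have bad: "forbidden_edge m F y = forbidden_edge m' F y"
  proof (rule ext, clarify)
    fix c d
    have "{f \<in> dom F. m f \<ge> m (c, d) \<and> fst f \<noteq> y \<and> snd f \<noteq> y} =
        {f \<in> dom F. m' f \<ge> m' (c, d) \<and> fst f \<noteq> y \<and> snd f \<noteq> y}" if "F (c, d) = Some CC"
    proof -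
      have "m (c, d) = m' (c, d)" using that by (intro mF) (simp add: domIff)
      then show ?thesis by (intro Collect_cong) (simp add: mF cong: conj_cong)
    qed
    then show "forbidden_edge m F y (c, d) \<longleftrightarrow> forbidden_edge m' F y (c, d)"
      by (auto simp: forbidden_edge_def)
  qed
  have cycle: "reject_cycle A m F x y \<longleftrightarrow> reject_cycle A m' F x y"
    using strong[of "\<lambda>_. True"] strong[of "\<lambda>f. \<not> forbidden_edge m' F y f"]
    by (simp add: reject_cycle_iff strong_edges_def bad)
  have add: "add_edge m F x y = add_edge m' F x y"
    by (rule ext) (simp add: add_edge_apply xy inc cong: conj_cong)
  have "m f = m' f" if "f \<in> cycle_edges (add_edge m' F x y) x y" for f
    using that m e by (auto simp: cycle_edges_def dom_add_edge)
  then have "mark_cycles m (add_edge m F x y) x y = mark_cycles m' (add_edge m' F x y) x y"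
    unfolding add by (intro ext) (auto simp: mark_cycles_apply xy)
  then show ?thesis by (simp add: fun_step_def e dominated cycle)
qed

lemma fold_fun_step_cong:
  assumes "\<And>f. f \<in> set es \<union> dom F \<Longrightarrow> m f = m' f"
  shows "fold (fun_step A m) es F = fold (fun_step A m') es F"
  using assms
proof (induction es arbitrary: F)
  case (Cons e es)
  have "fun_step A m e F = fun_step A m' e F" by (rule fun_step_cong) (use Cons.prems in auto)
  moreover have "m f = m' f" if "f \<in> set es \<union> dom (fun_step A m' e F)" for f
  proof (rule Cons.prems)
    show "f \<in> set (e # es) \<union> dom F" using that dom_fun_step[of A m' e F] by auto
  qed
  ultimately show ?case using Cons.IH by simp
qed simp


section \<open>The main loop\<close>

lemma relabelled_simps [simp]:
  "vertices (G\<lparr>label := f\<rparr>) = vertices G" "number (G\<lparr>label := f\<rparr>) = number G"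
  "cell (G\<lparr>label := f\<rparr>) = cell G" "laid_out (G\<lparr>label := f\<rparr>) = laid_out G"
  "at_vertex (G\<lparr>label := f\<rparr>) = at_vertex G"
  by (simp_all add: vertices_def number_def cell_def laid_out_def well_numbered_def at_vertex_def
      fun_eq_iff)

definition array_labels :: "'a labelled_graph \<Rightarrow> 'a rel \<Rightarrow> (int \<Rightarrow> int) \<Rightarrow> ('a \<times> 'a \<Rightarrow> int) \<Rightarrow> bool" where
  "array_labels G E f \<beta> \<longleftrightarrow> (\<forall>(u, w)\<in>E. f (int (cell G u w)) = \<beta> (u, w))"

lemma array_labels_empty [simp]: "array_labels G {} f \<beta>"
  by (simp add: array_labels_def)

lemma array_labels_insert:
  assumes "well_numbered G" "insert (u, w) E \<subseteq> vertices G \<times> vertices G" "array_labels G E f \<beta>"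
  shows "array_labels G (insert (u, w) E) (f(int (cell G u w) := \<beta> (u, w))) \<beta>"
proof -
  have "cell G u' w' = cell G u w \<longleftrightarrow> u' = u \<and> w' = w" if "(u', w') \<in> E" for u' w'
    using that assms(2) by (intro cell_eq_iff[OF assms(1)]) auto
  with assms(3) show ?thesis by (auto simp: array_labels_def)
qed

lemma represents_relabelled:
  assumes rep: "represents d G \<rho> s" and a: "a \<in> matrices" and frame: "unchanged d {a} s s'"
    and new: "array_labels G (vertices G \<times> vertices G) (s' a) \<beta>"
  shows "represents d (G\<lparr>label := (label G)(a := \<beta>)\<rparr>) \<rho> s'"
proof -
  have "s' b = s b" if "b \<in> matrices" "b \<noteq> a" for b
    by (rule unchanged_arrayD[OF frame]) (use that in auto)
  moreover have "laid_out G s'"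
    using represents_laid_out[OF rep] a by (intro unchanged_laid_out[OF frame]) auto
  moreover have "at_vertex G k (\<rho> k) s'" if "k < d" for k
    by (rule iffD2[OF unchanged_at_vertex[OF frame that] represents_at_vertex[OF rep that]])
  ultimately show ?thesis
    using rep new by (auto simp: represents_def stores_def array_labels_def)
qed

definition loop_cell :: "nat \<Rightarrow> aexp" where
  "loop_cell d = position (index d) (index (Suc d))"

lemma aval_loop_cell:
  assumes "laid_out G s" "at_vertex G d u s" "at_vertex G (Suc d) w s"
  shows "aval (loop_cell d) s = int (cell G u w)"
  unfolding loop_cell_def
  using assms by (intro aval_position aval_index_at_vertex) (auto dest: at_vertex_in)

text \<open>The new labels are buffered, since each of them depends on all old ones.\<close>

definition relabel :: "nat \<Rightarrow> vname \<Rightarrow> com \<Rightarrow> com" where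
  "relabel d a c =
     Seq (for_pairs d (Seq c (Put (scratch d) (loop_cell d) (Get ''res'' (Const 0)))))
       (for_pairs d (Put a (loop_cell d) (Get (scratch d) (loop_cell d))))"

definition buffered ::
  "nat \<Rightarrow> ('a labelled_graph \<Rightarrow> 'a \<times> 'a \<Rightarrow> int) \<Rightarrow>
    'a labelled_graph \<times> (nat \<Rightarrow> 'a) \<times> state \<Rightarrow> 'a rel \<Rightarrow> state \<Rightarrow> bool" where
  "buffered d \<beta> = (\<lambda>(G, \<rho>, s0) E s. intermediate d (G, \<rho>, s0) s \<and>
     array_labels G E (s (scratch d)) (\<beta> G))"

lemma buffered_unchanged:
  assumes "buffered d \<beta> x E s" "unchanged (Suc d) {} s s'"
  shows "buffered d \<beta> x E s'"
  using assms(1) unchanged_scratchD[OF assms(2), of d] intermediate_unchanged[OF _ assms(2), of d x]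
  by (cases x) (auto simp: buffered_def)

lemma polytime_buffer:
  fixes \<beta> :: "'a labelled_graph \<Rightarrow> 'a \<times> 'a \<Rightarrow> int"
  assumes c: "computes (Suc (Suc d)) c (\<lambda>G \<rho>. \<beta> G (\<rho> d, \<rho> (Suc d)))"
  shows "polytime (\<lambda>x. buffered d \<beta> x {})
    (for_pairs d (Seq c (Put (scratch d) (loop_cell d) (Get ''res'' (Const 0)))))
    (\<lambda>x. buffered d \<beta> x (vertices (fst x) \<times> vertices (fst x)))"
proof (rule polytime_for_vertex_pairs[OF polytime_computes_Seq[OF c, where G = "fst \<circ> fst" and
        \<rho> = "\<lambda>((_, \<rho>, _), _, u, w). \<rho>(d := u, Suc d := w)"]], goal_cases)
  case (1 y s)
  then show ?case
    by (auto simp: buffered_def intro!: represents_Suc intro: intermediate_represents)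
next
  case (2 y s s')
  then have "unchanged (Suc d) {} s s'" by (auto elim: unchanged_mono)
  with 2 show ?case by (auto simp: unchanged_at_vertex intro: buffered_unchanged)
next
  case 3
  show ?case
  proof (rule polytime_Put, goal_cases)
    case (2 y s)
    obtain G \<rho> s0 E u w where y: "y = ((G, \<rho>, s0), E, u, w)" by (metis surj_pair)
    with 2 have uw: "at_vertex G d u s" "at_vertex G (Suc d) w s"
      and E: "insert (u, w) E \<subseteq> vertices G \<times> vertices G" "array_labels G E (s (scratch d)) (\<beta> G)"
      and I: "intermediate d (G, \<rho>, s0) s" by (auto simp: buffered_def dest: at_vertex_in)
    note G = intermediate_laid_out[OF I]
    from array_labels_insert[OF laid_out_well_numbered[OF G] E] show ?case
      using 2 aval_loop_cell[OF G uw] I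
      by (auto simp: y buffered_def intro: intermediate_upd)
  qed simp
next
  case (4 x E s)
  then show ?case by (auto simp: buffered_def split: prod.splits intro: intermediate_laid_out)
next
  case (5 x E l j s)
  then show ?case by (cases x) (auto simp: buffered_def intro: intermediate_set_index)
qed

definition storing ::
  "nat \<Rightarrow> vname \<Rightarrow> ('a labelled_graph \<Rightarrow> 'a \<times> 'a \<Rightarrow> int) \<Rightarrow>
    'a labelled_graph \<times> state \<Rightarrow> 'a rel \<Rightarrow> state \<Rightarrow> bool" where
  "storing d a \<beta> = (\<lambda>(G, s0) E s. laid_out G s \<and> unchanged d {a} s0 s \<and>
     array_labels G (vertices G \<times> vertices G) (s (scratch d)) (\<beta> G) \<and>
     array_labels G E (s a) (\<beta> G))"

lemma polytime_storing:
  fixes \<beta> :: "'a labelled_graph \<Rightarrow> 'a \<times> 'a \<Rightarrow> int"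
  assumes a: "a \<in> matrices"
  shows "polytime (\<lambda>x. storing d a \<beta> x {})
    (for_pairs d (Put a (loop_cell d) (Get (scratch d) (loop_cell d))))
    (\<lambda>x. storing d a \<beta> x (vertices (fst x) \<times> vertices (fst x)))"
proof -
  have a_neq: "a \<noteq> ''n''" "a \<noteq> ''row''" "a \<noteq> ''i''" "a \<noteq> scratch d" using a by auto
  show ?thesis
  proof (rule polytime_for_vertex_pairs[where I = "storing d a \<beta>" and G = fst, OF polytime_Put],
      goal_cases)
    case (2 y s)
    obtain G s0 E u w where y: "y = ((G, s0), E, u, w)" by (metis surj_pair)
    with 2 have G: "laid_out G s" and uw: "at_vertex G d u s" "at_vertex G (Suc d) w s"
      and E: "insert (u, w) E \<subseteq> vertices G \<times> vertices G" "array_labels G E (s a) (\<beta> G)"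
      by (auto simp: storing_def dest: at_vertex_in)
    then have buffer: "s (scratch d) (int (cell G u w)) = \<beta> G (u, w)"
      using 2 by (simp add: y storing_def array_labels_def)
    have "laid_out G (s(a := f))" for f using G a_neq by (simp add: laid_out_def)
    with array_labels_insert[OF laid_out_well_numbered[OF G] E]
    show ?case
      using 2 aval_loop_cell[OF G uw] buffer a_neq
      by (auto simp: y storing_def intro: unchanged_upd)
  next
    case (4 x E l j s)
    with a_neq show ?case by (cases x) (auto simp: storing_def laid_out_def)
  qed (use a_neq in \<open>auto simp: storing_def\<close>)
qed

lemma polytime_store_buffer:
  fixes \<beta> :: "'a labelled_graph \<Rightarrow> 'a \<times> 'a \<Rightarrow> int"
  assumes a: "a \<in> matrices"
  shows "polytime (\<lambda>x. buffered d \<beta> x (vertices (fst x) \<times> vertices (fst x)))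
    (for_pairs d (Put a (loop_cell d) (Get (scratch d) (loop_cell d))))
    (\<lambda>(G, \<rho>, s0) s. represents d (G\<lparr>label := (label G)(a := \<beta> G)\<rparr>) \<rho> s \<and> unchanged d {a} s0 s)"
proof (rule polytime_conseq[OF polytime_storing[OF a, of d \<beta>]], goal_cases)
  case (1 x s)
  obtain G \<rho> s0 where x: "x = (G, \<rho>, s0)" by (rule prod_cases3)
  with 1 have rep: "represents d G \<rho> s" and frame: "unchanged d {} s0 s"
    by (auto simp: buffered_def intermediate_def)
  have "storing d a \<beta> (G, s) {} s"
    using 1 represents_laid_out[OF rep] by (simp add: x storing_def buffered_def)
  moreover have "represents d (G\<lparr>label := (label G)(a := \<beta> G)\<rparr>) \<rho> s' \<and> unchanged d {a} s0 s'"
    if "storing d a \<beta> (G, s) (vertices G \<times> vertices G) s'" for s'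
    using that represents_relabelled[OF rep a] unchanged_trans[OF unchanged_mono[OF frame]]
    by (auto simp: storing_def)
  ultimately show ?case by (auto simp: x)
qed

lemma polytime_relabel:
  fixes \<beta> :: "'a labelled_graph \<Rightarrow> 'a \<times> 'a \<Rightarrow> int"
  assumes "computes (Suc (Suc d)) c (\<lambda>G \<rho>. \<beta> G (\<rho> d, \<rho> (Suc d)))" and "a \<in> matrices"
  shows "polytime (\<lambda>(G, \<rho>, s0) s. s = s0 \<and> represents d G \<rho> s) (relabel d a c)
    (\<lambda>(G, \<rho>, s0) s. represents d (G\<lparr>label := (label G)(a := \<beta> G)\<rparr>) \<rho> s \<and> unchanged d {a} s0 s)"
proof -
  note polytime_Seq[OF polytime_buffer[OF assms(1)] polytime_store_buffer[OF assms(2)]]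
  then show ?thesis
    unfolding relabel_def by (rule polytime_pre) (auto simp: buffered_def intermediate_def)
qed

definition main_loop :: "com \<Rightarrow> com" where
  "main_loop c = for_pairs 0 (relabel 2 ''S'' c)"

lemma polytime_process_next:
  assumes "computes 4 c (\<lambda>(G :: 'a labelled_graph) \<rho>. next_status G (\<rho> 2, \<rho> 3))"
  shows "polytime (\<lambda>(G :: 'a labelled_graph, \<rho>, s0) s. s = s0 \<and> represents 2 G \<rho> s)
    (relabel 2 ''S'' c)
    (\<lambda>(G, \<rho>, s0) s. represents 2 (process_next G) \<rho> s \<and> unchanged 2 {''S''} s0 s)"
  using polytime_relabel[of 2 c next_status "''S''"] assms
  by (simp add: process_next_def matrices_def numeral_eq_Suc)

lemma polytime_main_loop:
  assumes c: "computes 4 c (\<lambda>(G :: 'a labelled_graph) \<rho>. next_status G (\<rho> 2, \<rho> 3))"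
  shows "polytime (\<lambda>(G :: 'a labelled_graph, s0) s. s = s0 \<and> stores G s) (main_loop c)
    (\<lambda>(G, s0) s. stores ((process_next ^^ card (vertices G \<times> vertices G)) G) s \<and>
      unchanged 0 {''S''} s0 s)"
proof -
  define I where "I = (\<lambda>(G :: 'a labelled_graph, s0) (E :: 'a rel) s.
    stores ((process_next ^^ card E) G) s \<and> unchanged 0 {''S''} s0 s)"
  have "polytime (\<lambda>x. I x {}) (main_loop c) (\<lambda>x. I x (vertices (fst x) \<times> vertices (fst x)))"
    unfolding main_loop_def
  proof (rule polytime_for_vertex_pairs[OF polytime_conseq[OF polytime_process_next[OF c]]],
      goal_cases)
    case (1 y s)
    obtain G s0 E u w where y: "y = ((G, s0), E, u, w)" by (metis surj_pair)
    define G' where "G' = (process_next ^^ card E) G"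
    define \<rho> where "\<rho> k = (if k = 0 then u else w)" for k :: nat
    have at_vertex: "at_vertex G' = at_vertex G"
      by (simp add: G'_def at_vertex_def number_def fun_eq_iff)
    from 1 have st: "stores G' s" and frame: "unchanged 0 {''S''} s0 s"
      and uw: "at_vertex G 0 u s" "at_vertex G 1 w s" by (auto simp: y I_def G'_def)
    have "finite E" using 1 by (auto simp: y intro: finite_subset)
    then have card: "card (insert (u, w) E) = Suc (card E)" using 1 by (simp add: y)
    have "represents 2 G' \<rho> s"
      using st uw by (auto simp: represents_def \<rho>_def at_vertex less_2_cases_iff)
    moreover have "I (G, s0) (insert (u, w) E) s' \<and> at_vertex G 0 u s' \<and> at_vertex G 1 w s'"
      if "represents 2 (process_next G') \<rho> s'" "unchanged 2 {''S''} s s'" for s'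
      using represents_stores[OF that(1)] unchanged_trans[OF frame unchanged_mono[OF that(2)]]
        unchanged_at_vertex[OF that(2), where G = G] uw
      by (simp add: I_def card G'_def)
    ultimately show ?case by (intro exI[of _ "(G', \<rho>, s)"]) (auto simp: y)
  next
    case (2 x E s)
    then have "laid_out ((process_next ^^ card E) (fst x)) s"
      by (cases x) (auto simp: I_def intro: stores_laid_out)
    then show ?case by (simp add: laid_out_def)
  next
    case (3 x E l j s)
    then show ?case
      by (cases x) (auto simp: I_def intro: unchanged_stores[where d = 0 and X = "{}" and s = s])
  qed
  then show ?thesis by (rule polytime_pre[OF polytime_post]) (auto simp: I_def)
qed

definition tabulate :: "vname \<Rightarrow> com \<Rightarrow> com" where
  "tabulate a c = for_loop 0 (Seq c (Put a (index 0) (Get ''res'' (Const 0))))"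

definition tabulating ::
  "vname \<Rightarrow> ('a labelled_graph \<Rightarrow> 'a \<Rightarrow> int) \<Rightarrow> 'a labelled_graph \<times> state \<Rightarrow> 'a set \<Rightarrow> state \<Rightarrow> bool" where
  "tabulating a \<alpha> = (\<lambda>(G, s0) U s. stores G s \<and> unchanged 0 {a} s0 s \<and>
     (\<forall>u\<in>U. s a (int (number G u)) = \<alpha> G u))"

lemma tabulating_unchanged:
  assumes "tabulating a \<alpha> x U s" "unchanged 0 {} s s'" "s' a = s a"
  shows "tabulating a \<alpha> x U s'"
proof -
  have "unchanged 0 {a} s s'" using assms(2) by (rule unchanged_mono) simp_all
  then show ?thesis
    using assms(1,3) unchanged_stores[OF assms(2)]
    by (cases x) (auto simp: tabulating_def intro: unchanged_trans)
qed

lemma tabulating_insert: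
  assumes I: "tabulating a \<alpha> (G, s0) U s" and a: "a \<notin> {''n'', ''row'', ''i''} \<union> matrices"
    and U: "insert u U \<subseteq> vertices G"
  shows "tabulating a \<alpha> (G, s0) (insert u U) (s(a := (s a)(int (number G u) := \<alpha> G u)))"
    (is "tabulating a \<alpha> (G, s0) _ ?s")
proof -
  from I have st: "stores G s" and frame: "unchanged 0 {a} s0 s" by (auto simp: tabulating_def)
  have step: "unchanged 0 {a} s ?s" using a by (auto intro: unchanged_upd)
  have "number G u' = number G u \<longleftrightarrow> u' = u" if "u' \<in> U" for u'
    using that U laid_out_well_numbered[OF stores_laid_out[OF st]] by (intro number_eq_iff) auto
  moreover have "stores G ?s" using a by (intro unchanged_stores[OF step st]) auto
  ultimately show ?thesis
    using I unchanged_trans[OF frame step] by (auto simp: tabulating_def)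
qed

lemma polytime_tabulate:
  assumes c: "computes 1 c (\<lambda>(G :: 'a labelled_graph) \<rho>. \<alpha> G (\<rho> 0))"
    and a: "a \<notin> {''n'', ''row'', ''i'', ''res''} \<union> matrices \<union> range scratch"
  shows "polytime (\<lambda>(G :: 'a labelled_graph, s0) s. s = s0 \<and> stores G s) (tabulate a c)
    (\<lambda>(G, s0) s. unchanged 0 {a} s0 s \<and> (\<forall>u\<in>vertices G. s a (int (number G u)) = \<alpha> G u))"
proof -
  have "polytime (\<lambda>x. tabulating a \<alpha> x {}) (tabulate a c) (\<lambda>x. tabulating a \<alpha> x (vertices (fst x)))"
    unfolding tabulate_def
  proof (rule polytime_for_vertices[OF polytime_computes_Seq[OF c, where G = "fst \<circ> fst"
          and \<rho> = "\<lambda>(_, _, u) _. u"]], goal_cases)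
    case (1 y s)
    then show ?case by (auto simp: tabulating_def represents_def)
  next
    case (2 y s s')
    have "s' a = s a" using a by (intro unchanged_arrayD[OF 2(2)]) auto
    moreover have "unchanged 0 {} s s'" using 2(2) by (rule unchanged_mono) simp_all
    ultimately show ?case using 2 by (auto simp: unchanged_at_vertex intro: tabulating_unchanged)
  next
    case 3
    show ?case
    proof (rule polytime_Put, goal_cases)
      case (2 y s)
      obtain G s0 U u where y: "y = ((G, s0), U, u)" by (metis surj_pair)
      with 2 have u: "at_vertex G 0 u s" by simp
      with 2 a show ?case
        by (auto simp: y aval_index_at_vertex[OF u] at_vertex_in simp del: aval_index
            intro!: tabulating_insert[where \<alpha> = \<alpha>, simplified])
    qed (use a in simp)
  next
    case (4 x U s)
    then show ?case by (cases x) (auto simp: tabulating_def intro: stores_laid_out)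
  next
    case (5 x U j s)
    with a show ?case by (auto intro: tabulating_unchanged[where s = s])
  qed
  then show ?thesis by (rule polytime_pre[OF polytime_post]) (auto simp: tabulating_def)
qed


section \<open>Input and output\<close>

record 'a digraph_input =
  order_of :: nat
  vertex_of :: "nat \<Rightarrow> 'a"
  adj_of :: "nat \<Rightarrow> nat list"
  weight_of :: "'a \<times> 'a \<Rightarrow> int"
  rank_of :: "'a \<times> 'a \<Rightarrow> int"

definition valid_input :: "'a digraph_input \<Rightarrow> bool" where
  "valid_input X \<longleftrightarrow> inj_on (vertex_of X) {..<order_of X} \<and>
     (\<forall>i<order_of X. distinct (adj_of X i) \<and> set (adj_of X i) \<subseteq> {..<order_of X})"

definition initial_state :: "'a digraph_input \<Rightarrow> state" where
  "initial_state X = input_state (order_of X) (vertex_of X) (adj_of X) (weight_of X) (rank_of X)"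

definition vertices_of :: "'a digraph_input \<Rightarrow> 'a set" where
  "vertices_of X = vertex_of X ` {..<order_of X}"

definition listed_edge :: "'a digraph_input \<Rightarrow> nat \<times> nat \<Rightarrow> 'a \<times> 'a" where
  "listed_edge X = (\<lambda>(i, j). (vertex_of X i, vertex_of X (adj_of X i ! j)))"

definition list_indices :: "'a digraph_input \<Rightarrow> (nat \<times> nat) set" where
  "list_indices X = {(i, j). i < order_of X \<and> j < length (adj_of X i)}"

definition edges_of :: "'a digraph_input \<Rightarrow> ('a \<times> 'a) set" where
  "edges_of X = listed_edge X ` list_indices X"

definition offset :: "(nat \<Rightarrow> nat list) \<Rightarrow> nat \<Rightarrow> nat" where
  "offset adj i = (\<Sum>l<i. length (adj l))"

lemma offset_Suc: "offset adj (Suc i) = offset adj i + length (adj i)"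
  by (simp add: offset_def)

lemma along_adj_Suc: "along_adj (Suc n) adj f = along_adj n adj f @ map (f n) (adj n)"
  by (simp add: along_adj_def)

lemma length_along_adj: "length (along_adj n adj f) = offset adj n"
  by (induction n) (simp_all add: along_adj_Suc offset_Suc along_adj_def[of 0] offset_def[of _ 0])

lemma nth_along_adj:
  assumes "i < n" "j < length (adj i)"
  shows "offset adj i + j < offset adj n"
    and "along_adj n adj f ! (offset adj i + j) = f i (adj i ! j)"
proof -
  have "offset adj i + j < offset adj n \<and> along_adj n adj f ! (offset adj i + j) = f i (adj i ! j)"
    using assms(1)
  proof (induction n)
    case (Suc n)
    then show ?case
      using assms(2)
      by (cases "i = n") (auto simp: along_adj_Suc offset_Suc nth_append length_along_adj)
  qed simp
  then show "offset adj i + j < offset adj n"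
    and "along_adj n adj f ! (offset adj i + j) = f i (adj i ! j)" by auto
qed

lemma along_adj_position:
  "q < offset adj n \<Longrightarrow> \<exists>i<n. \<exists>j<length (adj i). q = offset adj i + j"
proof (induction n)
  case (Suc n)
  show ?case
  proof (cases "q < offset adj n")
    case False
    with Suc.prems have "q - offset adj n < length (adj n)" "q = offset adj n + (q - offset adj n)"
      by (auto simp: offset_Suc)
    then show ?thesis by blast
  qed (use Suc.IH less_Suc_eq in blast)
qed (simp add: offset_def)

lemma list_indices_bounds:
  assumes "valid_input X" "(i, j) \<in> list_indices X"
  shows "i < order_of X" "j < order_of X" "adj_of X i ! j < order_of X"
proof -
  from assms have i: "i < order_of X" "j < length (adj_of X i)" and adj: "distinct (adj_of X i)"
    "set (adj_of X i) \<subseteq> {..<order_of X}"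
    by (auto simp: list_indices_def valid_input_def)
  then have "length (adj_of X i) \<le> card {..<order_of X}"
    by (metis card_mono distinct_card finite_lessThan)
  moreover have "adj_of X i ! j \<in> {..<order_of X}" using adj(2) nth_mem[OF i(2)] by (rule subsetD)
  ultimately show "i < order_of X" "j < order_of X" "adj_of X i ! j < order_of X"
    using i by simp_all
qed

lemma edges_of_subset: "valid_input X \<Longrightarrow> edges_of X \<subseteq> vertices_of X \<times> vertices_of X"
  using list_indices_bounds[of X] by (force simp: edges_of_def listed_edge_def vertices_of_def)

definition dense_graph :: "'a digraph_input \<Rightarrow> (vname \<Rightarrow> 'a \<times> 'a \<Rightarrow> int) \<Rightarrow> 'a labelled_graph" where
  "dense_graph X f = \<lparr>num_vertices = order_of X, vertex = vertex_of X, label = f\<rparr>"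

lemma dense_graph_simps [simp]:
  "num_vertices (dense_graph X f) = order_of X" "vertex (dense_graph X f) = vertex_of X"
  "label (dense_graph X f) = f" "vertices (dense_graph X f) = vertices_of X"
  "well_numbered (dense_graph X f) \<longleftrightarrow> inj_on (vertex_of X) {..<order_of X}"
  by (simp_all add: dense_graph_def vertices_def vertices_of_def well_numbered_def)

lemma number_dense_graph:
  "valid_input X \<Longrightarrow> i < order_of X \<Longrightarrow> number (dense_graph X f) (vertex_of X i) = i"
  using number_vertex[of "dense_graph X f" i] by (simp add: valid_input_def)

definition keeps_input :: "'a digraph_input \<Rightarrow> state \<Rightarrow> bool" where
  "keeps_input X s \<longleftrightarrow> valid_input X \<and> laid_out (dense_graph X (\<lambda>_ _. 0)) s \<and>
     (\<forall>a\<in>{''off'', ''head'', ''weight'', ''rank''}. s a = initial_state X a)"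

lemma keeps_input_laid_out: "keeps_input X s \<Longrightarrow> laid_out (dense_graph X f) s"
  by (simp add: keeps_input_def laid_out_def)

lemma keeps_input_valid: "keeps_input X s \<Longrightarrow> valid_input X"
  by (simp add: keeps_input_def)

lemma keeps_input_off:
  "keeps_input X s \<Longrightarrow> i \<le> order_of X \<Longrightarrow> s ''off'' (int i) = int (offset (adj_of X) i)"
  by (simp add: keeps_input_def initial_state_def input_state_def array_of_def offset_def
      del: upt_Suc)

lemma keeps_input_nth:
  assumes "keeps_input X s" "(i, j) \<in> list_indices X"
  shows "s ''head'' (int (offset (adj_of X) i + j)) = int (adj_of X i ! j)"
    and "s ''weight'' (int (offset (adj_of X) i + j)) = weight_of X (listed_edge X (i, j))"
    and "s ''rank'' (int (offset (adj_of X) i + j)) = rank_of X (listed_edge X (i, j))"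
  using assms
  by (simp_all add: nth_along_adj keeps_input_def initial_state_def input_state_def array_of_def
      length_along_adj list_indices_def listed_edge_def del: of_nat_add)

lemma keeps_input_upd [simp]:
  "a \<notin> {''n'', ''row'', ''off'', ''head'', ''weight'', ''rank''} \<Longrightarrow>
    keeps_input X (s(a := f)) \<longleftrightarrow> keeps_input X s"
  by (auto simp: keeps_input_def laid_out_def)

lemma keeps_input_unchanged:
  assumes "keeps_input X s" "unchanged d Y s s'" "Y \<subseteq> matrices"
  shows "keeps_input X s'"
proof -
  have "s' a = s a" if "a \<in> {''off'', ''head'', ''weight'', ''rank''}" for a
    by (rule unchanged_arrayD[OF assms(2)])
      (use that assms(3) in \<open>auto simp: matrices_def scratch_def\<close>)
  moreover have "laid_out (dense_graph X (\<lambda>_ _. 0)) s'"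
    by (rule unchanged_laid_out[OF assms(2) keeps_input_laid_out[OF assms(1)]])
      (use assms(3) in \<open>auto simp: matrices_def\<close>)
  ultimately show ?thesis using assms(1) by (simp add: keeps_input_def)
qed

lemma keeps_input_set_index [simp]: "keeps_input X (set_index k j s) \<longleftrightarrow> keeps_input X s"
  by (simp add: keeps_input_def laid_out_def)

definition list_position :: aexp where
  "list_position = Add (Get ''off'' (index 0)) (index 1)"

lemma aval_list_position:
  "keeps_input X s \<Longrightarrow> s ''i'' 0 = int i \<Longrightarrow> s ''i'' 1 = int j \<Longrightarrow> i < order_of X \<Longrightarrow>
    aval list_position s = int (offset (adj_of X) i + j)"
  by (simp add: list_position_def keeps_input_off)

definition within_list :: bexp where
  "within_list = Less list_position (Get ''off'' (Add (index 0) (Const 1)))"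

definition for_lists :: "com \<Rightarrow> com" where
  "for_lists c = for_pairs 0 (Cond within_list c Skip)"

lemma bval_within_list:
  assumes "keeps_input X s" "s ''i'' 0 = int i" "s ''i'' 1 = int j" "i < order_of X"
  shows "bval within_list s \<longleftrightarrow> (i, j) \<in> list_indices X"
  using assms keeps_input_off[of X s "Suc i"]
  by (auto simp: within_list_def aval_list_position list_indices_def offset_Suc add.commute)

text \<open>
  No adjacency list is longer than the number of vertices, so that a loop over all pairs of vertices
  visits every list position \<open>j\<close>, identified with vertex number \<open>j\<close>.
\<close>

definition visited :: "'a digraph_input \<Rightarrow> 'a rel \<Rightarrow> (nat \<times> nat) set" where
  "visited X E = {(i, j) \<in> list_indices X. (vertex_of X i, vertex_of X j) \<in> E}"

lemma visited_empty [simp]: "visited X {} = {}"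
  by (simp add: visited_def)

lemma visited_insert:
  assumes "valid_input X" "i < order_of X" "j < order_of X"
  shows "visited X (insert (vertex_of X i, vertex_of X j) E) =
    {(i, j)} \<inter> list_indices X \<union> visited X E"
  using assms list_indices_bounds[OF assms(1)]
  by (fastforce simp: visited_def valid_input_def dest: inj_onD)

lemma visited_all: "valid_input X \<Longrightarrow> visited X (vertices_of X \<times> vertices_of X) = list_indices X"
  using list_indices_bounds[of X] by (fastforce simp: visited_def vertices_of_def)

lemma visit_vertex_pair:
  assumes keeps: "keeps_input X s"
    and uw: "at_vertex (dense_graph X f) 0 u s" "at_vertex (dense_graph X f) 1 w s"
  obtains i j where "s ''i'' 0 = int i" "s ''i'' 1 = int j"
    and "bval within_list s \<longleftrightarrow> (i, j) \<in> list_indices X"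
    and "visited X (insert (u, w) E) = {(i, j)} \<inter> list_indices X \<union> visited X E"
proof -
  note valid = keeps_input_valid[OF keeps]
  from uw obtain i j where bounds: "i < order_of X" "j < order_of X"
    and ij: "u = vertex_of X i" "w = vertex_of X j"
    by (auto simp: at_vertex_def vertices_of_def)
  moreover have regs: "s ''i'' 0 = int i" "s ''i'' 1 = int j"
    using uw bounds ij by (simp_all add: at_vertex_def number_dense_graph[OF valid])
  ultimately show ?thesis
    using visited_insert[OF valid bounds] bval_within_list[OF keeps] that by simp
qed

lemma polytime_visit:
  fixes X :: "'x \<Rightarrow> 'a digraph_input"
  defines "at_pair \<equiv> \<lambda>x u w s. at_vertex (dense_graph (X x) (\<lambda>_ _. 0)) 0 u s \<and>
    at_vertex (dense_graph (X x) (\<lambda>_ _. 0)) (Suc 0) w s"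
  assumes body: "polytime (\<lambda>(x, D, i, j) s. I x D s \<and> (i, j) \<in> list_indices (X x) \<and>
        s ''i'' 0 = int i \<and> s ''i'' 1 = int j) c
      (\<lambda>(x, D, i, j) s. I x (insert (i, j) D) s \<and> s ''i'' 0 = int i \<and> s ''i'' 1 = int j)"
    and input: "\<And>x D s. I x D s \<Longrightarrow> keeps_input (X x) s"
  shows "polytime (\<lambda>(x, E, u, w) s. I x (visited (X x) E) s \<and> at_pair x u w s)
    (Cond within_list c Skip)
    (\<lambda>(x, E, u, w) s. I x (visited (X x) (insert (u, w) E)) s \<and> at_pair x u w s)"
proof -
  have visit: "\<exists>i j. s ''i'' 0 = int i \<and> s ''i'' 1 = int j \<and>
      (bval within_list s \<longleftrightarrow> (i, j) \<in> list_indices (X x)) \<and>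
      visited (X x) (insert (u, w) E) = {(i, j)} \<inter> list_indices (X x) \<union> visited (X x) E"
    if "I x (visited (X x) E) s" "at_pair x u w s" for x E u w s
  proof -
    from that(2) have uw: "at_vertex (dense_graph (X x) (\<lambda>_ _. 0)) 0 u s"
      "at_vertex (dense_graph (X x) (\<lambda>_ _. 0)) 1 w s" by (simp_all add: at_pair_def)
    show ?thesis by (rule visit_vertex_pair[OF input[OF that(1)] uw, of E]) blast
  qed
  show ?thesis
  proof (rule polytime_Cond_Skip[OF polytime_conseq[OF body]], goal_cases)
    case (1 y s)
    obtain x E u w where y: "y = (x, E, u, w)" by (metis surj_pair)
    with 1 visit obtain i j where "s ''i'' 0 = int i" "s ''i'' 1 = int j"
      "(i, j) \<in> list_indices (X x)"
      "visited (X x) (insert (u, w) E) = insert (i, j) (visited (X x) E)" by fastforce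
    with 1 show ?case
      by (intro exI[of _ "(x, visited (X x) E, i, j)"]) (auto simp: y at_pair_def at_vertex_def)
  next
    case (2 y s)
    obtain x E u w where y: "y = (x, E, u, w)" by (metis surj_pair)
    with 2 visit[of x E s u w] show ?case by auto
  qed
qed

lemma polytime_for_lists:
  fixes X :: "'x \<Rightarrow> 'a digraph_input"
  assumes body: "polytime (\<lambda>(x, D, i, j) s. I x D s \<and> (i, j) \<in> list_indices (X x) \<and>
        s ''i'' 0 = int i \<and> s ''i'' 1 = int j) c
      (\<lambda>(x, D, i, j) s. I x (insert (i, j) D) s \<and> s ''i'' 0 = int i \<and> s ''i'' 1 = int j)"
    and input: "\<And>x D s. I x D s \<Longrightarrow> keeps_input (X x) s"
    and frame: "\<And>x D s k j. I x D s \<Longrightarrow> I x D (set_index k j s)"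
  shows "polytime (\<lambda>x. I x {}) (for_lists c) (\<lambda>x. I x (list_indices (X x)))"
proof -
  have "polytime (\<lambda>x. I x (visited (X x) {})) (for_lists c)
      (\<lambda>x. I x (visited (X x) (vertices_of (X x) \<times> vertices_of (X x))))"
    unfolding for_lists_def
  proof (rule polytime_for_vertex_pairs[where I = "\<lambda>x E. I x (visited (X x) E)"
        and G = "\<lambda>x. dense_graph (X x) (\<lambda>_ _. 0)", unfolded dense_graph_simps], goal_cases)
    case 1
    show ?case by (rule polytime_pre[OF polytime_visit[OF body input]]) auto
  qed (auto intro: frame keeps_input_laid_out[OF input])
  then show ?thesis
    unfolding visited_empty
  proof (rule polytime_post)
    fix x s assume I: "I x (visited (X x) (vertices_of (X x) \<times> vertices_of (X x))) s"
    with visited_all[OF keeps_input_valid[OF input[OF I]]] show "I x (list_indices (X x)) s" by simp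
  qed
qed

definition list_cell :: aexp where
  "list_cell = position (index 0) (Get ''head'' list_position)"

lemma aval_list_cell:
  assumes input: "keeps_input X s"
    and ij: "(i, j) \<in> list_indices X" "s ''i'' 0 = int i" "s ''i'' 1 = int j"
  shows "aval list_cell s =
    int (cell (dense_graph X f) (vertex_of X i) (vertex_of X (adj_of X i ! j)))"
proof -
  note valid = keeps_input_valid[OF input]
  note bounds = list_indices_bounds[OF valid ij(1)]
  then show ?thesis
    unfolding list_cell_def
    using input ij
    by (intro aval_position[OF keeps_input_laid_out[OF input]])
      (simp_all add: aval_list_position keeps_input_nth number_dense_graph[OF valid] vertices_of_def
        del: of_nat_add)
qed

lemma listed_edge_vertices:
  assumes "valid_input X" "(i, j) \<in> list_indices X"
  shows "vertex_of X i \<in> vertices_of X" "vertex_of X (adj_of X i ! j) \<in> vertices_of X"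
  using list_indices_bounds[OF assms] by (simp_all add: vertices_of_def)

lemma stores_put:
  assumes "stores (dense_graph X f) s" "a \<in> matrices" "u \<in> vertices_of X" "w \<in> vertices_of X"
  shows "stores (dense_graph X (f(a := (f a)((u, w) := z))))
    (s(a := (s a)(int (cell (dense_graph X f) u w) := z)))"
proof -
  let ?G = "dense_graph X f"
  have G': "dense_graph X (f(a := (f a)((u, w) := z))) =
      ?G\<lparr>label := (label ?G)(a := (label ?G a)((u, w) := z))\<rparr>"
    by (simp add: dense_graph_def)
  have "cell ?G u' w' = cell ?G u w \<longleftrightarrow> u' = u \<and> w' = w"
    if "u' \<in> vertices ?G" "w' \<in> vertices ?G" for u' w'
    using that assms(3,4) laid_out_well_numbered[OF stores_laid_out[OF assms(1)]]
    by (intro cell_eq_iff) simp_all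
  moreover have "laid_out ?G (s(a := g)) = laid_out ?G s" for g
    using assms(2) by (auto simp: laid_out_def)
  ultimately show ?thesis
    using assms(1) unfolding G' stores_def relabelled_simps by simp
qed

definition scatter :: "vname \<Rightarrow> aexp \<Rightarrow> com" where
  "scatter a e = for_lists (Put a list_cell e)"

definition scattered ::
  "vname \<Rightarrow> ('a digraph_input \<Rightarrow> 'a \<times> 'a \<Rightarrow> int) \<Rightarrow> ('a digraph_input \<Rightarrow> vname \<Rightarrow> 'a \<times> 'a \<Rightarrow> int) \<Rightarrow>
    'a digraph_input \<Rightarrow> (nat \<times> nat) set \<Rightarrow> vname \<Rightarrow> 'a \<times> 'a \<Rightarrow> int" where
  "scattered a val f X D = (f X)(a := \<lambda>e. if e \<in> listed_edge X ` D then val X e else f X a e)"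

lemma scattered_empty: "scattered a val f X {} = f X"
  by (simp add: scattered_def)

lemma scattered_insert:
  "scattered a val f X (insert p D) = (scattered a val f X D)
    (a := (scattered a val f X D a)(listed_edge X p := val X (listed_edge X p)))"
  by (auto simp: scattered_def fun_eq_iff)

lemma polytime_scatter:
  fixes f :: "'a digraph_input \<Rightarrow> vname \<Rightarrow> 'a \<times> 'a \<Rightarrow> int"
  assumes a: "a \<in> matrices"
    and e: "\<And>X s i j. keeps_input X s \<Longrightarrow> (i, j) \<in> list_indices X \<Longrightarrow> s ''i'' 0 = int i \<Longrightarrow>
      s ''i'' 1 = int j \<Longrightarrow> aval e s = val X (listed_edge X (i, j))"
  shows "polytime (\<lambda>X s. keeps_input X s \<and> stores (dense_graph X (f X)) s) (scatter a e)
    (\<lambda>X s. keeps_input X s \<and> stores (dense_graph X (scattered a val f X (list_indices X))) s)"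
proof -
  define I where "I = (\<lambda>X D s. keeps_input X s \<and> stores (dense_graph X (scattered a val f X D)) s)"
  have a_neq: "a \<notin> {''n'', ''row'', ''i'', ''off'', ''head'', ''weight'', ''rank''}"
    using a by (auto simp: matrices_def)
  have "polytime (\<lambda>X. I X {}) (scatter a e) (\<lambda>X. I X (list_indices X))"
    unfolding scatter_def
  proof (rule polytime_for_lists[OF polytime_Put], goal_cases)
    case (2 y s)
    obtain X D i j where y: "y = (X, D, i, j)" by (metis surj_pair)
    with 2 have input: "keeps_input X s" and st: "stores (dense_graph X (scattered a val f X D)) s"
      and ij: "(i, j) \<in> list_indices X" "s ''i'' 0 = int i" "s ''i'' 1 = int j"
      by (auto simp: I_def)
    note cell = aval_list_cell[OF input ij, of "scattered a val f X D"]
    from stores_put[OF st a listed_edge_vertices[OF keeps_input_valid[OF input] ij(1)],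
        of "val X (listed_edge X (i, j))"]
    have "I X (insert (i, j) D) (s(a := (s a)(aval list_cell s := val X (listed_edge X (i, j)))))"
      unfolding cell using a_neq input by (auto simp: I_def scattered_insert listed_edge_def)
    then show ?case using a_neq ij e[OF input ij] by (auto simp: y)
  next
    case (4 X D s k j)
    then show ?case
      by (auto simp: I_def intro: unchanged_stores[where d = 0 and X = "{}" and s = s])
  qed (use a_neq in \<open>auto simp: I_def\<close>)
  then show ?thesis by (simp add: I_def scattered_empty)
qed

definition load_rows :: com where
  "load_rows = for_loop 0 (Put ''row'' (Add (index 0) (Const 1))
     (Add (Get ''row'' (index 0)) (Get ''n'' (Const 0))))"

definition loading_rows :: "'a digraph_input \<Rightarrow> nat \<Rightarrow> state \<Rightarrow> bool" where
  "loading_rows X k s \<longleftrightarrow> valid_input X \<and>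
     (\<forall>a. a \<notin> {''i'', ''row''} \<longrightarrow> s a = initial_state X a) \<and>
     (\<forall>i\<le>k. s ''row'' (int i) = int (i * order_of X))"

lemma initial_state_simps:
  "initial_state X ''n'' 0 = int (order_of X)" "input_size (initial_state X) = order_of X"
  "initial_state X ''row'' = (\<lambda>_. 0)" "a \<in> matrices \<Longrightarrow> initial_state X a = (\<lambda>_. 0)"
  by (auto simp: initial_state_def input_state_def array_of_def matrices_def input_size_def)

lemma loading_rows_size:
  assumes "loading_rows X k s"
  shows "s ''n'' 0 = int (order_of X)" "input_size s = order_of X"
  using assms by (simp_all add: loading_rows_def input_size_def initial_state_simps)

lemma loading_rows_0: "valid_input X \<Longrightarrow> loading_rows X 0 (initial_state X)"
  by (simp add: loading_rows_def initial_state_simps)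

lemma loading_rows_Suc:
  assumes "loading_rows X k s"
  shows "loading_rows X (Suc k) (s(''row'' := (s ''row'')
    (int k + 1 := s ''row'' (int k) + s ''n'' 0)))"
proof -
  have "int k + 1 = int (Suc k)" "s ''row'' (int k) + s ''n'' 0 = int (Suc k * order_of X)"
    using assms loading_rows_size(1)[OF assms] by (simp_all add: loading_rows_def)
  with assms show ?thesis
    by (auto simp: loading_rows_def le_Suc_eq simp del: of_nat_Suc of_nat_mult)
qed

lemma loading_rows_set_index: "loading_rows X k (set_index l j s) \<longleftrightarrow> loading_rows X k s"
  by (simp add: loading_rows_def)

lemma loading_rows_all:
  assumes "loading_rows X (input_size s) s"
  shows "keeps_input X s \<and> stores (dense_graph X (\<lambda>_ _. 0)) s"
proof -
  have "s a = (\<lambda>_. 0)" if "a \<in> matrices" for a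
  proof -
    have "a \<notin> {''i'', ''row''}" using that by auto
    then have "s a = initial_state X a" using assms unfolding loading_rows_def by blast
    with that show ?thesis by (simp add: initial_state_simps)
  qed
  with assms loading_rows_size[OF assms] show ?thesis
    by (simp add: loading_rows_def keeps_input_def stores_def laid_out_def valid_input_def)
qed

lemma polytime_load_rows:
  "polytime (\<lambda>X s. valid_input X \<and> s = initial_state X) load_rows
    (\<lambda>X s. keeps_input X s \<and> stores (dense_graph X (\<lambda>_ _. 0)) s)"
proof -
  have "polytime (\<lambda>X. loading_rows X 0) load_rows (\<lambda>X s. loading_rows X (input_size s) s)"
    unfolding load_rows_def
    by (intro polytime_for_loop polytime_Put) (auto simp: loading_rows_Suc loading_rows_set_index)
  then show ?thesis
    by (rule polytime_pre[OF polytime_post])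
      (auto simp: loading_rows_0 loading_rows_all)
qed

definition load_graph :: com where
  "load_graph = Seq load_rows (Seq (scatter ''W'' (Get ''weight'' list_position))
     (Seq (scatter ''R'' (Get ''rank'' list_position)) (scatter ''S'' (Const (-1)))))"

definition loaded_graph :: "'a digraph_input \<Rightarrow> 'a labelled_graph" where
  "loaded_graph X = dense_graph X ((\<lambda>_ _. 0)
     (''W'' := \<lambda>e. if e \<in> edges_of X then weight_of X e else 0,
      ''R'' := \<lambda>e. if e \<in> edges_of X then rank_of X e else 0,
      ''S'' := \<lambda>e. if e \<in> edges_of X then -1 else 0))"

lemma polytime_load_graph:
  "polytime (\<lambda>X s. valid_input X \<and> s = initial_state X) load_graph
    (\<lambda>X s. keeps_input X s \<and> stores (loaded_graph X) s)"
proof -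
  define W where
    "W = (\<lambda>X :: 'a digraph_input. scattered ''W'' weight_of (\<lambda>_ _ _. 0) X (list_indices X))"
  define R where "R = (\<lambda>X. scattered ''R'' rank_of W X (list_indices X))"
  define S where "S = (\<lambda>X. scattered ''S'' (\<lambda>_ _. -1) R X (list_indices X))"
  have position: "aval list_position s = int (offset (adj_of X) i + j)"
    if "keeps_input X s" "(i, j) \<in> list_indices X" "s ''i'' 0 = int i" "s ''i'' 1 = int j"
    for X :: "'a digraph_input" and s i j
    using that by (intro aval_list_position) (simp_all add: list_indices_def)
  have load_W: "polytime (\<lambda>X s. keeps_input X s \<and> stores (dense_graph X (\<lambda>_ _. 0)) s)
      (scatter ''W'' (Get ''weight'' list_position))
      (\<lambda>X s. keeps_input X s \<and> stores (dense_graph X (W X)) s)"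
    unfolding W_def
    by (rule polytime_scatter) (simp_all add: position keeps_input_nth matrices_def del: of_nat_add)
  have load_R: "polytime (\<lambda>X s. keeps_input X s \<and> stores (dense_graph X (W X)) s)
      (scatter ''R'' (Get ''rank'' list_position))
      (\<lambda>X s. keeps_input X s \<and> stores (dense_graph X (R X)) s)"
    unfolding R_def
    by (rule polytime_scatter) (simp_all add: position keeps_input_nth matrices_def del: of_nat_add)
  have load_S: "polytime (\<lambda>X s. keeps_input X s \<and> stores (dense_graph X (R X)) s)
      (scatter ''S'' (Const (-1))) (\<lambda>X s. keeps_input X s \<and> stores (dense_graph X (S X)) s)"
    unfolding S_def by (rule polytime_scatter) (simp_all add: matrices_def)
  have "dense_graph X (S X) = loaded_graph X" for X
    by (simp add: loaded_graph_def S_def R_def W_def scattered_def edges_of_def fun_eq_iff)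
  then show ?thesis
    using polytime_Seq[OF polytime_load_rows polytime_Seq[OF load_W polytime_Seq[OF load_R load_S]]]
    by (simp only: load_graph_def)
qed

lemma outputs_diagram_iff:
  "outputs_diagram (order_of X) (vertex_of X) (adj_of X) s F \<longleftrightarrow>
    (\<forall>(i, j)\<in>list_indices X. s ''state'' (int (offset (adj_of X) i + j)) =
      along_adj (order_of X) (adj_of X) (\<lambda>i j. state_code (F (vertex_of X i, vertex_of X j))) !
        (offset (adj_of X) i + j))"
proof -
  let ?cs = "along_adj (order_of X) (adj_of X)
    (\<lambda>i j. state_code (F (vertex_of X i, vertex_of X j)))"
  have "(\<forall>q<offset (adj_of X) (order_of X). s ''state'' (int q) = ?cs ! q) \<longleftrightarrow>
      (\<forall>i<order_of X. \<forall>j<length (adj_of X i).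
        s ''state'' (int (offset (adj_of X) i + j)) = ?cs ! (offset (adj_of X) i + j))"
    using along_adj_position nth_along_adj(1) by metis
  then show ?thesis
    by (auto simp: outputs_diagram_def length_along_adj list_indices_def simp del: of_nat_add)
qed

definition store_diagram :: com where
  "store_diagram = for_lists (Put ''state'' list_position (Get ''S'' list_cell))"

lemma aval_list_status:
  assumes "keeps_input X s" "stores (dense_graph X f) s"
    and "(i, j) \<in> list_indices X" "s ''i'' 0 = int i" "s ''i'' 1 = int j"
  shows "aval (Get ''S'' list_cell) s = f ''S'' (listed_edge X (i, j))"
  using assms storesD[OF assms(2), of "''S''"]
    listed_edge_vertices[OF keeps_input_valid[OF assms(1)]]
  by (simp add: aval_list_cell[where f = f] matrices_def listed_edge_def)

lemma polytime_store_diagram: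
  "polytime (\<lambda>(X, f, F) s. keeps_input X s \<and> stores (dense_graph X f) s \<and>
      (\<forall>e\<in>edges_of X. f ''S'' e = state_code (F e)))
    store_diagram
    (\<lambda>(X, f, F) s. stores (dense_graph X f) s \<and>
      outputs_diagram (order_of X) (vertex_of X) (adj_of X) s F)"
proof -
  define cs where "cs = (\<lambda>(X :: 'a digraph_input) F. along_adj (order_of X) (adj_of X)
    (\<lambda>i j. state_code (F (vertex_of X i, vertex_of X j))))"
  define I where "I = (\<lambda>(X, f, F) D s. keeps_input X s \<and> stores (dense_graph X f) s \<and>
    (\<forall>e\<in>edges_of X. f ''S'' e = state_code (F e)) \<and>
    (\<forall>(i, j)\<in>D. s ''state'' (int (offset (adj_of X) i + j)) = cs X F ! (offset (adj_of X) i + j)))"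
  have "polytime (\<lambda>x. I x {}) store_diagram (\<lambda>x. I x (list_indices (fst x)))"
    unfolding store_diagram_def
  proof (rule polytime_for_lists[OF polytime_Put], goal_cases)
    case (2 y s)
    obtain X f F D i j where y: "y = ((X, f, F), D, i, j)" by (metis surj_pair)
    with 2 have input: "keeps_input X s" and st: "stores (dense_graph X f) s"
      and codes: "\<forall>e\<in>edges_of X. f ''S'' e = state_code (F e)"
      and ij: "(i, j) \<in> list_indices X" "s ''i'' 0 = int i" "s ''i'' 1 = int j"
      by (auto simp: I_def)
    have "listed_edge X (i, j) \<in> edges_of X" using ij(1) by (simp add: edges_of_def)
    then have "aval (Get ''S'' list_cell) s = cs X F ! (offset (adj_of X) i + j)"
      using aval_list_status[OF input st ij] codes ij(1)
      by (simp add: cs_def list_indices_def listed_edge_def nth_along_adj)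
    moreover have "aval list_position s = int (offset (adj_of X) i + j)"
      using input ij by (auto simp: aval_list_position list_indices_def)
    moreover have "stores (dense_graph X f) (s(''state'' := g))" for g
      by (rule unchanged_stores[OF _ st, where X = "{''state''}"]) (auto intro: unchanged_upd)
    ultimately show ?case using 2 by (auto simp: y I_def simp del: of_nat_add)
  next
    case (4 x D s k j)
    then show ?case
      by (cases x) (auto simp: I_def intro: unchanged_stores[where d = 0 and X = "{}" and s = s])
  qed (auto simp: I_def)
  then show ?thesis
    by (rule polytime_pre[OF polytime_post]) (auto simp: I_def cs_def outputs_diagram_iff)
qed

lemma decidable_winners:
  assumes "i < d"
  shows "decidable d (\<lambda>G \<rho>. \<rho> i \<in> winners (vertices G) (diagram G))"
proof -
  have "decidable d (\<lambda>G \<rho>. cycle_dominated (diagram G) (\<rho> i) \<or> not_dominated (diagram G) (\<rho> i))"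
    using assms by (intro decidable_intros)
  then show ?thesis by (rule decidable_cong) (use assms in \<open>simp add: winners_def valuation_def\<close>)
qed


section \<open>The complete program\<close>

lemma loaded_graph_simps [simp]:
  "vertex (loaded_graph X) = vertex_of X" "num_vertices (loaded_graph X) = order_of X"
  "vertices (loaded_graph X) = vertices_of X"
  "label (loaded_graph X) ''S'' e = (if e \<in> edges_of X then -1 else state_code None)"
  by (simp_all add: loaded_graph_def)

lemma well_numbered_loaded_graph: "valid_input X \<Longrightarrow> well_numbered (loaded_graph X)"
  by (simp add: loaded_graph_def valid_input_def)

lemma pending_loaded_graph: "valid_input X \<Longrightarrow> pending (loaded_graph X) = edges_of X"
  using edges_of_subset by (auto simp: pending_def)

lemma diagram_loaded_graph: "diagram (loaded_graph X) = Map.empty"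
  by (rule ext) (simp add: diagram_def del: state_code.simps)

lemma consistent_loaded_graph: "valid_input X \<Longrightarrow> consistent (loaded_graph X)"
  by (simp add: consistent_def pending_loaded_graph diagram_loaded_graph)

definition final_graph :: "'a digraph_input \<Rightarrow> 'a labelled_graph" where
  "final_graph X = (process_next ^^ (card (vertices_of X) * card (vertices_of X))) (loaded_graph X)"

lemma final_graph_simps [simp]:
  "num_vertices (final_graph X) = order_of X" "vertex (final_graph X) = vertex_of X"
  "vertices (final_graph X) = vertices_of X"
  by (simp_all add: final_graph_def)

lemma final_graph_eq_dense_graph: "final_graph X = dense_graph X (label (final_graph X))"
  by (rule labelled_graph.equality) simp_all

lemma final_graph_processed:
  assumes "valid_input X"
  obtains es where "processing_order (weight_of X) (edges_of X) (rank_of X) es"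
    and "pending (final_graph X) = {}"
    and "diagram (final_graph X) = fun_diagram (vertices_of X) (weight_of X) es"
proof -
  let ?G = "loaded_graph X"
  have V: "finite (vertices_of X \<times> vertices_of X)" by (simp add: vertices_of_def)
  then have "finite (edges_of X)" using edges_of_subset[OF assms] by (rule finite_subset[rotated])
  then obtain es where es: "distinct es" "set es = edges_of X" "sorted (map (edge_key ?G) es)"
    using ex_sorted_enumeration by blast
  have "length es \<le> card (vertices_of X) * card (vertices_of X)"
    using card_mono[OF V edges_of_subset[OF assms]] distinct_card[OF es(1)] es(2)
    by (simp add: card_cartesian_product)
  then have final: "pending (final_graph X) = {}"
    "diagram (final_graph X) = fold (fun_step (vertices_of X) (weight ?G)) es Map.empty"
    using process_all[OF well_numbered_loaded_graph[OF assms] es(1) _ es(3)] es(2)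
    by (simp_all add: final_graph_def pending_loaded_graph[OF assms] diagram_loaded_graph)
  have labels: "weight ?G e = weight_of X e \<and> label ?G ''R'' e = rank_of X e"
    if "e \<in> edges_of X" for e
    using that by (simp add: loaded_graph_def)
  then have "diagram (final_graph X) = fun_diagram (vertices_of X) (weight_of X) es"
    unfolding final(2) fun_diagram_def by (intro fold_fun_step_cong) (simp add: es(2))
  with final(1) processing_order_edge_key[OF es labels] show ?thesis by (intro that)
qed

lemma final_graph_status:
  assumes "valid_input X" "e \<in> edges_of X"
  shows "label (final_graph X) ''S'' e = state_code (diagram (final_graph X) e)"
proof -
  have "pending (final_graph X) = {}" using assms(1) by (rule final_graph_processed)
  moreover have "consistent (final_graph X)"
    using consistent_funpow[OF consistent_loaded_graph[OF assms(1)]] by (simp add: final_graph_def)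
  moreover have "e \<in> vertices (final_graph X) \<times> vertices (final_graph X)"
    using edges_of_subset[OF assms(1)] assms(2) by auto
  ultimately show ?thesis unfolding consistent_def by blast
qed

lemma polytime_compute_final_graph:
  assumes "computes 4 c (\<lambda>(G :: 'a labelled_graph) \<rho>. next_status G (\<rho> 2, \<rho> 3))"
  shows "polytime (\<lambda>(X :: 'a digraph_input) s. keeps_input X s \<and> stores (loaded_graph X) s)
    (main_loop c) (\<lambda>X s. keeps_input X s \<and> stores (final_graph X) s)"
proof (rule polytime_conseq[OF polytime_main_loop[OF assms]], goal_cases)
  case (1 X s)
  then show ?case
    using keeps_input_unchanged[of X s 0 "{''S''}"]
    by (intro exI[of _ "(loaded_graph X, s)"])
      (auto simp: final_graph_def matrices_def)
qed

lemma polytime_store_final_diagram: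
  "polytime (\<lambda>(X :: 'a digraph_input) s. keeps_input X s \<and> stores (final_graph X) s) store_diagram
    (\<lambda>X s. stores (final_graph X) s \<and>
      outputs_diagram (order_of X) (vertex_of X) (adj_of X) s (diagram (final_graph X)))"
proof (rule polytime_conseq[OF polytime_store_diagram[where 'a = 'a]], goal_cases)
  case (1 X s)
  then show ?case
    using final_graph_status[OF keeps_input_valid[of X s]]
    by (intro exI[of _ "(X, label (final_graph X), diagram (final_graph X))"])
      (simp flip: final_graph_eq_dense_graph)
qed

definition outputs_result :: "'a digraph_input \<Rightarrow> state \<Rightarrow> 'a diagram \<Rightarrow> bool" where
  "outputs_result X s F \<longleftrightarrow>
     outputs_diagram (order_of X) (vertex_of X) (adj_of X) s F \<and>
     outputs_set (order_of X) (vertex_of X) s (winners (vertices_of X) F)"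

lemma polytime_store_winners:
  assumes "computes 1 c
    (\<lambda>(G :: 'a labelled_graph) \<rho>. of_bool (\<rho> 0 \<in> winners (vertices G) (diagram G)))"
  shows "polytime (\<lambda>(X :: 'a digraph_input) s. stores (final_graph X) s \<and>
      outputs_diagram (order_of X) (vertex_of X) (adj_of X) s (diagram (final_graph X)))
    (tabulate ''winner'' c) (\<lambda>X s. outputs_result X s (diagram (final_graph X)))"
proof (rule polytime_conseq[OF polytime_tabulate[OF assms]], goal_cases)
  case (2 X s)
  let ?G = "final_graph X"
  have "well_numbered ?G" using 2 by (auto intro: laid_out_well_numbered stores_laid_out)
  then have "number ?G (vertex_of X i) = i" if "i < order_of X" for i
    using number_vertex[of ?G i] that by simp
  then have "outputs_set (order_of X) (vertex_of X) s' (winners (vertices_of X) (diagram ?G))"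
    if "\<forall>u\<in>vertices ?G.
      s' ''winner'' (int (number ?G u)) = of_bool (u \<in> winners (vertices ?G) (diagram ?G))" for s'
    using that by (simp add: outputs_set_def vertices_of_def of_bool_def)
  moreover have "outputs_diagram (order_of X) (vertex_of X) (adj_of X) s' (diagram ?G)"
    if "unchanged 0 {''winner''} s s'" for s'
    using 2 unchanged_arrayD[OF that, of "''state''"] by (simp add: outputs_diagram_def)
  ultimately show ?case using 2 by (intro exI[of _ "(?G, s)"]) (simp add: outputs_result_def)
qed (auto simp: scratch_def)

lemma ex_polytime_fun_program:
  "\<exists>c. polytime (\<lambda>(X :: 'a digraph_input) s. valid_input X \<and> s = initial_state X) c
      (\<lambda>X s. outputs_result X s (diagram (final_graph X)))"
proof -
  have "computable 4 (\<lambda>(G :: 'a labelled_graph) \<rho>. next_status G (\<rho> 2, \<rho> 3))"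
    by (rule computable_next_status) simp_all
  then obtain c where c: "computes 4 c (\<lambda>(G :: 'a labelled_graph) \<rho>. next_status G (\<rho> 2, \<rho> 3))"
    by (rule computableE)
  have "decidable 1 (\<lambda>(G :: 'a labelled_graph) \<rho>. \<rho> 0 \<in> winners (vertices G) (diagram G))"
    by (rule decidable_winners) simp
  then obtain w where w: "computes 1 w
      (\<lambda>(G :: 'a labelled_graph) \<rho>. of_bool (\<rho> 0 \<in> winners (vertices G) (diagram G)))"
    by (rule decidableE)
  from polytime_Seq[OF polytime_load_graph polytime_Seq[OF polytime_compute_final_graph[OF c]
        polytime_Seq[OF polytime_store_final_diagram polytime_store_winners[OF w]]]]
  show ?thesis by blast
qed

lemma ex_polynomially_bounded_fun_program:
  "\<exists>c (T :: nat poly). \<forall>X :: 'a digraph_input. valid_input X \<longrightarrow>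
     (\<exists>es t s. processing_order (weight_of X) (edges_of X) (rank_of X) es \<and>
        exec c (initial_state X) t s \<and> t \<le> poly T (order_of X) \<and>
        outputs_result X s (fun_diagram (vertices_of X) (weight_of X) es))"
proof -
  obtain c where c: "polytime (\<lambda>(X :: 'a digraph_input) s. valid_input X \<and> s = initial_state X) c
      (\<lambda>X s. outputs_result X s (diagram (final_graph X)))"
    using ex_polytime_fun_program by blast
  then obtain T where run: "\<And>(X :: 'a digraph_input) s. valid_input X \<and> s = initial_state X \<Longrightarrow>
      \<exists>t s'. exec c s t s' \<and> t \<le> poly T (input_size s) \<and> s' ''n'' = s ''n'' \<and>
        outputs_result X s' (diagram (final_graph X))"
    by (rule polytimeE) blast
  show ?thesis
  proof (intro exI[of _ c] exI[of _ T] allI impI)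
    fix X :: "'a digraph_input" assume X: "valid_input X"
    then obtain es where es: "processing_order (weight_of X) (edges_of X) (rank_of X) es"
      and F: "diagram (final_graph X) = fun_diagram (vertices_of X) (weight_of X) es"
      by (rule final_graph_processed)
    from run[of X "initial_state X"] X obtain t s where "exec c (initial_state X) t s"
      "t \<le> poly T (order_of X)" "outputs_result X s (diagram (final_graph X))"
      by (auto simp: initial_state_simps)
    with es show "\<exists>es t s. processing_order (weight_of X) (edges_of X) (rank_of X) es \<and>
        exec c (initial_state X) t s \<and> t \<le> poly T (order_of X) \<and>
        outputs_result X s (fun_diagram (vertices_of X) (weight_of X) es)"
      unfolding F by blast
  qed
qed

lemma adjacency_lists_input:
  assumes "adjacency_lists A E v adj" "E \<subseteq> A \<times> A"
    and X: "X = \<lparr>order_of = card A, vertex_of = v, adj_of = adj, weight_of = m, rank_of = rank\<rparr>"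
  shows "valid_input X" "edges_of X = E" "vertices_of X = A"
proof -
  from assms(1) have inj: "inj_on v {..<card A}" and A: "v ` {..<card A} = A"
    and adj: "\<And>i. i < card A \<Longrightarrow> distinct (adj i)"
      "\<And>i. i < card A \<Longrightarrow> set (adj i) = {j. j < card A \<and> (v i, v j) \<in> E}"
    by (auto simp: adjacency_lists_def bij_betw_def)
  show "valid_input X" using inj adj by (auto simp: X valid_input_def)
  show "vertices_of X = A" using A by (simp add: X vertices_of_def)
  have "edges_of X = {(v i, v j) | i j. i < card A \<and> j \<in> set (adj i)}"
    by (fastforce simp: X edges_of_def listed_edge_def list_indices_def in_set_conv_nth)
  also have "\<dots> = {(v i, v j) | i j. i < card A \<and> j < card A \<and> (v i, v j) \<in> E}"
    using adj(2) by auto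
  also have "\<dots> = E"
  proof (intro equalityI subrelI)
    fix x y assume "(x, y) \<in> E"
    moreover from this assms(2) A obtain i j where "i < card A" "x = v i" "j < card A" "y = v j"
      by blast
    ultimately show "(x, y) \<in> {(v i, v j) | i j. i < card A \<and> j < card A \<and> (v i, v j) \<in> E}"
      by blast
  qed auto
  finally show "edges_of X = E" .
qed

theorem theorem1:
  "\<exists>(c :: com) (T :: nat poly).
     \<forall>(A :: 'a set) P v adj rank.
       finite A \<and> profile A P \<and> adjacency_lists A (margin_edges A P) v adj \<longrightarrow>
       (\<exists>es t s. processing_order (margin P) (margin_edges A P) rank es \<and>
          exec c (input_state (card A) v adj (margin P) rank) t s \<and>
          t \<le> poly T (card A) \<and>
          outputs_diagram (card A) v adj s (fun_diagram A (margin P) es) \<and>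
          outputs_set (card A) v s (winners A (fun_diagram A (margin P) es)))"
proof -
  obtain c and T :: "nat poly" where run: "\<And>X :: 'a digraph_input. valid_input X \<Longrightarrow>
      \<exists>es t s. processing_order (weight_of X) (edges_of X) (rank_of X) es \<and>
        exec c (initial_state X) t s \<and> t \<le> poly T (order_of X) \<and>
        outputs_result X s (fun_diagram (vertices_of X) (weight_of X) es)"
    using ex_polynomially_bounded_fun_program by blast
  show ?thesis
  proof (intro exI[of _ c] exI[of _ T] allI impI)
    fix A :: "'a set" and P v adj and rank :: "'a \<times> 'a \<Rightarrow> int"
    assume "finite A \<and> profile A P \<and> adjacency_lists A (margin_edges A P) v adj"
    then have lists: "adjacency_lists A (margin_edges A P) v adj" by simp
    have edges: "margin_edges A P \<subseteq> A \<times> A" by (auto simp: margin_edges_def)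
    note X = adjacency_lists_input[OF lists edges refl, of "margin P" rank]
    from run[OF X(1)] show "\<exists>es t s. processing_order (margin P) (margin_edges A P) rank es \<and>
        exec c (input_state (card A) v adj (margin P) rank) t s \<and> t \<le> poly T (card A) \<and>
        outputs_diagram (card A) v adj s (fun_diagram A (margin P) es) \<and>
        outputs_set (card A) v s (winners A (fun_diagram A (margin P) es))"
      unfolding X(2,3) initial_state_def outputs_result_def by simp
  qed
qed

end
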